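(* Fix reals $\alpha,\beta,\gamma,\delta\ge0$ with $\alpha+\beta+\gamma+\delta=1$ and $\beta\delta=0$, and put $\xi:=\alpha+\beta$. Consider $n\to\infty$ along integers $n$ for which $l:=\alpha n$, $m:=\xi n$, $k:=(\alpha+\gamma)n$ are integers, and let $X$ be distributed according to $p(\cdot\mid n,m,k,l)$, with probability $\Pr_n$. If $\xi<1/2$ (resp. $\xi>1/2$) set $\mu:=\xi$ (resp. $\mu:=1-\xi$); this $\mu$ coincides with $(1-\sqrt{1-4(\alpha\gamma+\alpha\delta+\beta\gamma)})/2$. Then for every integer $i\ge0$, \[ \lim_{n\to\infty}\Pr_n[X=n\mu-i]=\Bigl(\frac{\mu}{1-\mu}\Bigr)^i\frac{1-2\mu}{1-\mu}, \] i.e. $n\mu-X$ is asymptotically geometric with parameter $\mu/(1-\mu)$, and moreover \[ \mathbb E[X]=n\mu-\frac{\mu}{1-2\mu}+o(1),\qquad \mathbb V[X]=\frac{\mu(1-\mu)}{(1-2\mu)^2}+o(1). \]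
   Context: For non-negative integers $n,m,k,l$ with $m,k\le n$ and $m+k-n\le l\le\min(m,k)$, let $M:=m-l$, $N:=n-m-k+l$. Let $\mathbb{C}^2$ have orthonormal basis $|0\rangle,|1\rangle$ and give $(\mathbb{C}^2)^{\otimes n}$ the induced Hermitian inner product. Define $|\Xi_{n,m|k,l}\rangle:=|1\rangle^{\otimes l}\otimes|0\rangle^{\otimes(k-l)}\otimes\binom{M+N}{M}^{-1/2}\sum_{I}|I\rangle$, the sum over all $I\in\{0,1\}^{n-k}$ with exactly $M$ ones (where $|i_1\cdots i_r\rangle=|i_1\rangle\otimes\cdots\otimes|i_r\rangle$). $\mathfrak S_n$ acts on $(\mathbb{C}^2)^{\otimes n}$ by permuting tensor factors. For $0\le x\le\lfloor n/2\rfloor$, $\mathsf P_{(n-x,x)}$ is the orthogonal projection onto the isotypic component of the irreducible $\mathfrak S_n$-representation labelled by the partition $(n-x,x)$, and $p(x\mid n,m,k,l):=\langle\Xi_{n,m|k,l}|\mathsf P_{(n-x,x)}|\Xi_{n,m|k,l}\rangle$, a probability mass function on $\{0,\dots,\lfloor n/2\rfloor\}$. *)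

theory Defs
  imports Complex_Main "HOL-Combinatorics.Permutations"
begin

text \<open>Vectors of (C^2)^{tensor n} are modelled as functions on bit strings
  (bool lists, True = |1>, False = |0>) vanishing off strings of length n.\<close>

type_synonym qvec = "bool list \<Rightarrow> complex"

definition tvecs :: "nat \<Rightarrow> qvec set" where
  "tvecs n = {v. \<forall>xs. length xs \<noteq> n \<longrightarrow> v xs = 0}"

definition qinner :: "nat \<Rightarrow> qvec \<Rightarrow> qvec \<Rightarrow> complex" where
  "qinner n u v = (\<Sum>xs\<in>{xs :: bool list. length xs = n}. cnj (u xs) * v xs)"

text \<open>Permutation of tensor factors: factor i is moved to position sigma i.\<close>
definition perm_act :: "(nat \<Rightarrow> nat) \<Rightarrow> qvec \<Rightarrow> qvec" where
  "perm_act \<sigma> v = (\<lambda>ys. v (permute_list \<sigma> ys))"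

definition cspan :: "qvec set \<Rightarrow> qvec set" where
  "cspan S = {v. \<exists>F c. finite F \<and> F \<subseteq> S \<and> v = (\<lambda>xs. \<Sum>u\<in>F. c u * u xs)}"

text \<open>Polytabloid of a two-row tableau of shape (n-x,x): the columns are
  (a i, b i) for i < x (a i in the first row, b i in the second row),
  all other entries lie in the first row.\<close>
definition polytabloid :: "nat \<Rightarrow> nat \<Rightarrow> (nat \<Rightarrow> nat) \<Rightarrow> (nat \<Rightarrow> nat) \<Rightarrow> qvec" where
  "polytabloid n x a b = (\<lambda>ys. if length ys = n then
      (\<Prod>i<x. (if \<not> ys ! (a i) \<and> ys ! (b i) then 1
               else if ys ! (a i) \<and> \<not> ys ! (b i) then -1 else 0))
      * (\<Prod>j\<in>{..<n} - (a ` {..<x} \<union> b ` {..<x}). (if ys ! j then 0 else 1))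
    else 0)"

definition tableau_cols :: "nat \<Rightarrow> nat \<Rightarrow> (nat \<Rightarrow> nat) \<Rightarrow> (nat \<Rightarrow> nat) \<Rightarrow> bool" where
  "tableau_cols n x a b \<longleftrightarrow> a ` {..<x} \<subseteq> {..<n} \<and> b ` {..<x} \<subseteq> {..<n} \<and>
     inj_on a {..<x} \<and> inj_on b {..<x} \<and> a ` {..<x} \<inter> b ` {..<x} = {}"

text \<open>Specht module S^{(n-x,x)}, realised inside (C^2)^{tensor n}
  (the permutation module M^{(n-x,x)} is the weight-x subspace).\<close>
definition specht :: "nat \<Rightarrow> nat \<Rightarrow> qvec set" where
  "specht n x = cspan {polytabloid n x a b | a b. tableau_cols n x a b}"

definition equivariant_map :: "nat \<Rightarrow> nat \<Rightarrow> (qvec \<Rightarrow> qvec) \<Rightarrow> bool" where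
  "equivariant_map n x f \<longleftrightarrow>
     (\<forall>u\<in>specht n x. f u \<in> tvecs n) \<and>
     (\<forall>u\<in>specht n x. \<forall>v\<in>specht n x. f (\<lambda>xs. u xs + v xs) = (\<lambda>xs. f u xs + f v xs)) \<and>
     (\<forall>u\<in>specht n x. \<forall>c. f (\<lambda>xs. c * u xs) = (\<lambda>xs. c * f u xs)) \<and>
     (\<forall>\<sigma>. \<sigma> permutes {..<n} \<longrightarrow> (\<forall>u\<in>specht n x. f (perm_act \<sigma> u) = perm_act \<sigma> (f u)))"

definition isotypic :: "nat \<Rightarrow> nat \<Rightarrow> qvec set" where
  "isotypic n x = cspan (\<Union>{f ` specht n x | f. equivariant_map n x f})"

definition orth_proj :: "nat \<Rightarrow> qvec set \<Rightarrow> qvec \<Rightarrow> qvec" where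
  "orth_proj n U v = (THE w. w \<in> U \<and> (\<forall>u\<in>U. qinner n u (\<lambda>xs. v xs - w xs) = 0))"

definition Xi :: "nat \<Rightarrow> nat \<Rightarrow> nat \<Rightarrow> nat \<Rightarrow> qvec" where
  "Xi n m k l = (\<lambda>xs. if length xs = n \<and> take l xs = replicate l True
      \<and> take (k - l) (drop l xs) = replicate (k - l) False
      \<and> length (filter id (drop k xs)) = m - l
    then complex_of_real (1 / sqrt (real ((n - k) choose (m - l)))) else 0)"

definition p_dist :: "nat \<Rightarrow> nat \<Rightarrow> nat \<Rightarrow> nat \<Rightarrow> nat \<Rightarrow> real" where
  "p_dist x n m k l = Re (qinner n (Xi n m k l) (orth_proj n (isotypic n x) (Xi n m k l)))"

definition prob_X :: "nat \<Rightarrow> nat \<Rightarrow> nat \<Rightarrow> nat \<Rightarrow> int \<Rightarrow> real" where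
  "prob_X n m k l j = (if 0 \<le> j \<and> j \<le> int (n div 2) then p_dist (nat j) n m k l else 0)"

definition expect_X :: "nat \<Rightarrow> nat \<Rightarrow> nat \<Rightarrow> nat \<Rightarrow> real" where
  "expect_X n m k l = (\<Sum>x\<le>n div 2. real x * p_dist x n m k l)"

definition var_X :: "nat \<Rightarrow> nat \<Rightarrow> nat \<Rightarrow> nat \<Rightarrow> real" where
  "var_X n m k l = (\<Sum>x\<le>n div 2. (real x)\<^sup>2 * p_dist x n m k l) - (expect_X n m k l)\<^sup>2"

end

theory Submission
  imports Defs "HOL-Analysis.Uniform_Limit"
begin

text \<open>Since \<open>\<beta>\<delta> = 0\<close>, the vector \<open>\<Xi>\<close> is a single computational basis vector of weight \<open>m\<close>. An
  equivariant map sends a polytabloid \<open>e\<close> to a vector with the same tableau symmetries, and such vectors are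
  combinations of the \<open>F\<^sup>j e\<close>, where \<open>F\<close> is the raising operator of the commuting \<open>sl\<^sub>2\<close>-action; so the
  isotypic component of \<open>(n-x,x)\<close> is spanned by all \<open>F\<^sup>j e\<close>. The \<open>sl\<^sub>2\<close>-relations make different components orthogonal and give each of
  them the same dimension \<open>d(x)\<close> in every weight from \<open>x\<close> to \<open>n-x\<close>. Permutation symmetry equidistributes
  the diagonal of the projection over the basis vectors of weight \<open>m\<close>, hence \<open>p(x) = d(x) / C(n,m)\<close>, and
  completeness gives \<open>d(0) + ... + d(y) = C(n,y)\<close> for \<open>2y \<le> n\<close>. With \<open>h = \<mu>n\<close> this says
  \<open>Pr(X \<le> h-i) = C(n,h-i) / C(n,h)\<close>, which tends to \<open>(\<mu>/(1-\<mu>))\<^sup>i\<close> and is bounded by it, so Tannery's theorem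
  yields the moments.\<close>

text \<open>If \<beta> = 0 the last n-k factors of \<Xi> all carry 0, if \<delta> = 0 they all carry
  1; either way the symmetric sum has a single term. The obstacle is that \<open>isotypic\<close>
  quantifies over all equivariant maps. The image of a polytabloid is pinned down by transpositions
  alone: a sign under each column swap and invariance outside the columns make it, in each weight, a
  multiple of one vector. On lowest weight vectors of weight x the power F^j multiplies inner
  products by a constant that is positive as long as 2x + j \<le> n and 0 beyond, whence the equal
  dimensions and the range of weights. Completeness rests on the invariance of the singlet:
  contracting two factors with it preserves lowest weight vectors, so a nonzero one can be
  contracted down to weight 0, and the factors used on the way are the columns of a polytabloid that
  is not orthogonal to it. The ratio \<mu>/(1-\<mu>) is the limit of C(n,h-i-1)/C(n,h-i) =
  (h-i)/(n-h+i+1).\<close>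

hide_const (open) Finite_Cartesian_Product.transpose

section \<open>Hamming weight of bit strings\<close>

definition wt :: "bool list \<Rightarrow> nat" where
  "wt ys = card {i. i < length ys \<and> ys ! i}"

lemma wt_conv_filter: "wt ys = length (filter id ys)"
  by (simp add: wt_def length_filter_conv_card)

lemma wt_update_True:
  assumes "i < length ys" "\<not> ys ! i"
  shows "wt (ys[i := True]) = Suc (wt ys)"
proof -
  have "{j. j < length (ys[i := True]) \<and> ys[i := True] ! j} = insert i {j. j < length ys \<and> ys ! j}"
    using assms by (auto simp: nth_list_update split: if_splits)
  then show ?thesis
    using assms by (simp add: wt_def)
qed

lemma wt_update_False:
  assumes "i < length ys" "ys ! i"
  shows "Suc (wt (ys[i := False])) = wt ys"
  using wt_update_True[of i "ys[i := False]"] assms list_update_id[of ys i] by simp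

lemma wt_permute_list:
  assumes "\<sigma> permutes {..<length ys}"
  shows "wt (permute_list \<sigma> ys) = wt ys"
proof -
  have "size (filter_mset id (mset (permute_list \<sigma> ys))) = size (filter_mset id (mset ys))"
    using assms by simp
  then show ?thesis
    by (metis mset_filter size_mset wt_conv_filter)
qed

lemma finite_strings [simp]: "finite {ys :: bool list. length ys = n}"
  using finite_lists_length_eq[of "UNIV :: bool set" n] by simp

lemma card_strings_wt: "card {ys. length ys = n \<and> wt ys = m} = n choose m"
proof -
  have "bij_betw (\<lambda>ys. {i. i < length ys \<and> ys ! i}) {ys. length ys = n \<and> wt ys = m}
      {A. A \<subseteq> {..<n} \<and> card A = m}"
  proof (rule bij_betwI[where g = "\<lambda>A. map (\<lambda>i. i \<in> A) [0..<n]"])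
    show "(\<lambda>A. map (\<lambda>i. i \<in> A) [0..<n])
        \<in> {A. A \<subseteq> {..<n} \<and> card A = m} \<rightarrow> {ys. length ys = n \<and> wt ys = m}"
    proof
      fix A assume A: "A \<in> {A. A \<subseteq> {..<n} \<and> card A = m}"
      then have "{i. i < n \<and> i \<in> A} = A" by auto
      then show "map (\<lambda>i. i \<in> A) [0..<n] \<in> {ys. length ys = n \<and> wt ys = m}"
        using A by (simp add: wt_def cong: conj_cong)
    qed
  qed (auto simp: wt_def intro!: nth_equalityI)
  then show ?thesis
    using n_subsets[of "{..<n}" m] by (simp add: bij_betw_same_card)
qed

subsection \<open>Subspaces and the inner product\<close>

definition csubspace :: "qvec set \<Rightarrow> bool" where
  "csubspace T \<longleftrightarrow> (\<lambda>xs. 0) \<in> T \<and> (\<forall>u\<in>T. \<forall>v\<in>T. \<forall>c. (\<lambda>xs. u xs + c * v xs) \<in> T)"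

lemma csubspace_sum:
  assumes "csubspace T" "\<And>i. i \<in> A \<Longrightarrow> f i \<in> T"
  shows "(\<lambda>xs. \<Sum>i\<in>A. c i * f i xs) \<in> T"
  using assms(2)
proof (induction A rule: infinite_finite_induct)
  case (insert i A)
  then have "(\<lambda>xs. (\<Sum>i\<in>A. c i * f i xs) + c i * f i xs) \<in> T"
    using assms(1) by (auto simp: csubspace_def)
  then show ?case
    using insert by (simp add: add.commute)
qed (use assms(1) in \<open>auto simp: csubspace_def\<close>)

lemma csubspace_scale: "csubspace T \<Longrightarrow> v \<in> T \<Longrightarrow> (\<lambda>xs. c * v xs) \<in> T"
  using csubspace_sum[of T "{()}" "\<lambda>_. v" "\<lambda>_. c"] by simp

lemma csubspace_add: "csubspace T \<Longrightarrow> u \<in> T \<Longrightarrow> v \<in> T \<Longrightarrow> (\<lambda>xs. u xs + v xs) \<in> T"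
  unfolding csubspace_def by (metis (no_types, lifting) ext lambda_one)

lemma csubspace_diff: "csubspace T \<Longrightarrow> u \<in> T \<Longrightarrow> v \<in> T \<Longrightarrow> (\<lambda>xs. u xs - v xs) \<in> T"
  using csubspace_add[of T u "\<lambda>xs. -1 * v xs"] csubspace_scale[of T v "-1"] by simp

lemma cspan_superset: "S \<subseteq> cspan S"
proof
  fix u assume "u \<in> S"
  then show "u \<in> cspan S"
    unfolding cspan_def by (auto intro!: exI[of _ "{u}"] exI[of _ "\<lambda>_. 1"])
qed

lemma csubspace_cspan: "csubspace (cspan S)"
  unfolding csubspace_def
proof (intro conjI ballI allI)
  show "(\<lambda>xs. 0) \<in> cspan S"
    unfolding cspan_def by (auto intro!: exI[of _ "{}"])
  fix u v c assume "u \<in> cspan S" "v \<in> cspan S"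
  then obtain F a G b where u: "finite F" "F \<subseteq> S" "u = (\<lambda>xs. \<Sum>w\<in>F. a w * w xs)"
    and v: "finite G" "G \<subseteq> S" "v = (\<lambda>xs. \<Sum>w\<in>G. b w * w xs)"
    unfolding cspan_def by blast
  \<comment> \<open>The two finite supports may overlap, so the coefficients are extended by 0 and
    added on the union.\<close>
  define d where "d w = (if w \<in> F then a w else 0) + c * (if w \<in> G then b w else 0)" for w
  have "(\<Sum>w\<in>F \<union> G. d w * w xs) = u xs + c * v xs" for xs
  proof -
    have "(\<Sum>w\<in>F \<union> G. d w * w xs) = (\<Sum>w\<in>F \<union> G. if w \<in> F then a w * w xs else 0)
        + c * (\<Sum>w\<in>F \<union> G. if w \<in> G then b w * w xs else 0)"
      unfolding sum_distrib_left sum.distrib[symmetric] by (rule sum.cong) (auto simp: d_def algebra_simps)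
    also have "(\<Sum>w\<in>F \<union> G. if w \<in> F then a w * w xs else 0) = (\<Sum>w\<in>F. a w * w xs)"
      by (rule sum.mono_neutral_cong_right) (use u(1) v(1) in auto)
    also have "(\<Sum>w\<in>F \<union> G. if w \<in> G then b w * w xs else 0) = (\<Sum>w\<in>G. b w * w xs)"
      by (rule sum.mono_neutral_cong_right) (use u(1) v(1) in auto)
    finally show ?thesis by (simp add: u v)
  qed
  then have "(\<lambda>xs. u xs + c * v xs) = (\<lambda>xs. \<Sum>w\<in>F \<union> G. d w * w xs)" by simp
  moreover have "finite (F \<union> G)" "F \<union> G \<subseteq> S" using u v by auto
  ultimately show "(\<lambda>xs. u xs + c * v xs) \<in> cspan S"
    unfolding cspan_def by blast
qed

lemma cspan_minimal: "csubspace T \<Longrightarrow> S \<subseteq> T \<Longrightarrow> cspan S \<subseteq> T"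
  by (auto simp: cspan_def intro!: csubspace_sum)

lemma csubspace_tvecs: "csubspace (tvecs n)"
  by (auto simp: csubspace_def tvecs_def)

lemma tvecs_eqI: "u \<in> tvecs n \<Longrightarrow> v \<in> tvecs n \<Longrightarrow> (\<And>ys. length ys = n \<Longrightarrow> u ys = v ys) \<Longrightarrow> u = v"
  unfolding tvecs_def by (rule ext) (metis (mono_tags, lifting) mem_Collect_eq)

lemma qinner_sum_right:
  "qinner n u (\<lambda>xs. \<Sum>i\<in>A. f i xs) = (\<Sum>i\<in>A. qinner n u (f i))"
  unfolding qinner_def sum_distrib_left by (rule sum.swap)

lemma qinner_sum_left:
  "qinner n (\<lambda>xs. \<Sum>i\<in>A. f i xs) u = (\<Sum>i\<in>A. qinner n (f i) u)"
  unfolding qinner_def cnj_sum sum_distrib_right by (rule sum.swap)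

lemma qinner_scale_right: "qinner n u (\<lambda>xs. c * v xs) = c * qinner n u v"
  by (simp add: qinner_def sum_distrib_left mult.left_commute)

lemma qinner_scale_left: "qinner n (\<lambda>xs. c * u xs) v = cnj c * qinner n u v"
  by (simp add: qinner_def sum_distrib_left mult.assoc)

lemma qinner_add_right: "qinner n u (\<lambda>xs. v xs + w xs) = qinner n u v + qinner n u w"
  by (simp add: qinner_def sum.distrib algebra_simps)

lemma qinner_diff_right: "qinner n u (\<lambda>xs. v xs - w xs) = qinner n u v - qinner n u w"
  by (simp add: qinner_def sum_subtractf algebra_simps)

lemma qinner_diff_left: "qinner n (\<lambda>xs. v xs - w xs) u = qinner n v u - qinner n w u"
  by (simp add: qinner_def sum_subtractf algebra_simps)

lemma qinner_cnj: "qinner n v u = cnj (qinner n u v)"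
  by (simp add: qinner_def mult.commute)

lemma qinner_zero_right [simp]: "qinner n u (\<lambda>xs. 0) = 0"
  by (simp add: qinner_def)

lemma qinner_self: "qinner n u u = complex_of_real (\<Sum>xs\<in>{xs. length xs = n}. (norm (u xs))\<^sup>2)"
  unfolding qinner_def of_real_sum
  by (rule sum.cong) (simp_all only: complex_norm_square mult.commute)

lemma qinner_self_eq_0:
  assumes "u \<in> tvecs n" "qinner n u u = 0"
  shows "u = (\<lambda>xs. 0)"
proof -
  have "\<forall>xs\<in>{xs. length xs = n}. (norm (u xs))\<^sup>2 = 0"
    using assms(2) unfolding qinner_self of_real_eq_0_iff
    by (subst (asm) sum_nonneg_eq_0_iff) auto
  then show ?thesis
    using assms(1) by (intro ext) (auto simp: tvecs_def)
qed

text \<open>\<open>qinner\<close> is conjugate linear in its first argument, so the left annihilator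
  of \<open>v\<close> is still a complex subspace.\<close>

lemma orthogonal_cspan:
  assumes "\<And>s. s \<in> S \<Longrightarrow> qinner n s v = 0" "u \<in> cspan S"
  shows "qinner n u v = 0"
proof -
  have "csubspace {u. qinner n u v = 0}"
    unfolding csubspace_def
    by (auto simp: qinner_def sum.distrib algebra_simps simp flip: sum_distrib_left)
  then show ?thesis
    using cspan_minimal[of "{u. qinner n u v = 0}" S] assms by auto
qed

definition orthonormal :: "nat \<Rightarrow> qvec set \<Rightarrow> bool" where
  "orthonormal n B \<longleftrightarrow> (\<forall>b\<in>B. \<forall>c\<in>B. qinner n b c = (if b = c then 1 else 0))"

definition proj_onto :: "nat \<Rightarrow> qvec set \<Rightarrow> qvec \<Rightarrow> qvec" where
  "proj_onto n B v = (\<lambda>xs. \<Sum>b\<in>B. qinner n b v * b xs)"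

lemma qinner_proj_onto:
  assumes "finite B" "orthonormal n B" "b \<in> B"
  shows "qinner n b (proj_onto n B v) = qinner n b v"
proof -
  have "qinner n b (proj_onto n B v) = (\<Sum>c\<in>B. qinner n c v * qinner n b c)"
    unfolding proj_onto_def qinner_sum_right qinner_scale_right ..
  also have "\<dots> = (\<Sum>c\<in>B. if b = c then qinner n c v else 0)"
    by (rule sum.cong) (use assms in \<open>auto simp: orthonormal_def\<close>)
  finally show ?thesis using assms by simp
qed

text \<open>Gram-Schmidt, one vector at a time. That \<open>B\<close> spans \<open>S\<close> is
  recorded as \<open>proj_onto n B s = s\<close>, the form in which later expansions use it.\<close>

lemma exists_orthonormal:
  assumes "finite S" "S \<subseteq> tvecs n"
  shows "\<exists>B. finite B \<and> B \<subseteq> cspan S \<and> orthonormal n B \<and> (\<forall>s\<in>S. proj_onto n B s = s)"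
  using assms
proof (induction S rule: finite_induct)
  case empty
  show ?case by (rule exI[of _ "{}"]) (auto simp: orthonormal_def)
next
  case (insert s S)
  then obtain B where B: "finite B" "B \<subseteq> cspan S" "orthonormal n B" "\<forall>s\<in>S. proj_onto n B s = s"
    by auto
  have mono: "cspan S \<subseteq> cspan (insert s S)"
    by (rule cspan_minimal[OF csubspace_cspan]) (use cspan_superset in blast)
  \<comment> \<open>The residue is orthogonal to the vectors found so far; if it vanishes,
    \<open>B\<close> already serves, otherwise its normalisation is the new vector.\<close>
  define r where "r = (\<lambda>xs. s xs - proj_onto n B s xs)"
  have "proj_onto n B s \<in> cspan (insert s S)"
    unfolding proj_onto_def by (rule csubspace_sum[OF csubspace_cspan]) (use B(2) mono in auto)
  moreover have s_in: "s \<in> cspan (insert s S)" using cspan_superset by blast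
  ultimately have r_in: "r \<in> cspan (insert s S)"
    unfolding r_def by (intro csubspace_diff[OF csubspace_cspan])
  have r_tv: "r \<in> tvecs n"
    using r_in cspan_minimal[OF csubspace_tvecs insert.prems] by auto
  have r_orth: "qinner n b r = 0" if "b \<in> B" for b
    unfolding r_def qinner_diff_right using qinner_proj_onto[OF B(1,3) that] by simp
  show ?case
  proof (cases "r = (\<lambda>xs. 0)")
    case True
    then have "proj_onto n B s = s"
      unfolding r_def by (metis (no_types) eq_iff_diff_eq_0 ext)
    then show ?thesis using B mono by (intro exI[of _ B]) auto
  next
    case False
    define N where "N = (\<Sum>xs\<in>{xs. length xs = n}. (norm (r xs))\<^sup>2)"
    have rr: "qinner n r r = complex_of_real N"
      unfolding N_def by (rule qinner_self)
    have "N \<noteq> 0" using False rr qinner_self_eq_0[OF r_tv] by auto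
    moreover have "N \<ge> 0" unfolding N_def by (intro sum_nonneg) auto
    ultimately have N: "N > 0" by simp
    define e where "e = (\<lambda>xs. complex_of_real (1 / sqrt N) * r xs)"
    have e_in: "e \<in> cspan (insert s S)"
      unfolding e_def by (rule csubspace_scale[OF csubspace_cspan r_in])
    have ee: "qinner n e e = 1"
    proof -
      have "qinner n e e = complex_of_real (1 / sqrt N * (1 / sqrt N) * N)"
        unfolding e_def qinner_scale_left qinner_scale_right rr
        by (simp only: of_real_mult complex_cnj_complex_of_real mult.assoc)
      also have "1 / sqrt N * (1 / sqrt N) * N = 1" using N by simp
      finally show ?thesis by simp
    qed
    have be: "qinner n b e = 0" if "b \<in> B" for b
      unfolding e_def qinner_scale_right using r_orth[OF that] by simp
    have eb: "qinner n e b = 0" if "b \<in> B" for b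
      using be[OF that] qinner_cnj[of n e b] by simp
    have e_notin: "e \<notin> B" using be ee by force
    have on: "orthonormal n (insert e B)"
      using B(3) ee be eb e_notin by (auto simp: orthonormal_def)
    have pr: "proj_onto n (insert e B) v = (\<lambda>xs. qinner n e v * e xs + proj_onto n B v xs)" for v
      using B(1) e_notin by (simp add: proj_onto_def)
    have eB: "qinner n e (proj_onto n B v) = 0" for v
      unfolding proj_onto_def qinner_sum_right qinner_scale_right using eb by simp
    have "proj_onto n (insert e B) t = t" if "t \<in> S" for t
      using B(4) that eB[of t] by (simp add: pr)
    moreover have "proj_onto n (insert e B) s = s"
    proof -
      have "s = (\<lambda>xs. r xs + proj_onto n B s xs)" by (simp add: r_def)
      then have "qinner n e s = qinner n e r"
        using qinner_add_right[of n e r "proj_onto n B s"] eB[of s] by simp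
      also have "\<dots> = complex_of_real (1 / sqrt N * N)"
        unfolding e_def qinner_scale_left rr by simp
      also have "1 / sqrt N * N = sqrt N" using N by (simp add: real_div_sqrt)
      finally have "qinner n e s * e xs = r xs" for xs
        using N by (simp add: e_def)
      then show ?thesis by (simp add: pr r_def)
    qed
    ultimately show ?thesis
      using B(1,2) mono e_in on by (intro exI[of _ "insert e B"]) auto
  qed
qed

lemma proj_onto_cspan:
  assumes "\<And>s. s \<in> S \<Longrightarrow> proj_onto n B s = s" "v \<in> cspan S"
  shows "proj_onto n B v = v"
proof -
  have "csubspace {v. proj_onto n B v = v}"
    by (auto simp: csubspace_def proj_onto_def qinner_add_right qinner_scale_right sum.distrib
        algebra_simps fun_eq_iff simp flip: sum_distrib_left)
  then show ?thesis
    using cspan_minimal[of "{v. proj_onto n B v = v}" S] assms by auto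
qed

text \<open>Uniqueness behind the \<open>THE\<close>: two candidates differ by a vector of
  \<open>U\<close> that is orthogonal to \<open>U\<close>, hence to itself.\<close>

lemma orth_proj_eqI:
  assumes U: "csubspace U" "U \<subseteq> tvecs n" and w: "w \<in> U"
    and orth: "\<And>u. u \<in> U \<Longrightarrow> qinner n u (\<lambda>xs. v xs - w xs) = 0"
  shows "orth_proj n U v = w"
  unfolding orth_proj_def
proof (rule the_equality)
  fix w' assume w': "w' \<in> U \<and> (\<forall>u\<in>U. qinner n u (\<lambda>xs. v xs - w' xs) = 0)"
  define d where "d = (\<lambda>xs. w' xs - w xs)"
  have d: "d \<in> U" unfolding d_def using U w w' by (intro csubspace_diff) auto
  have "qinner n d d = qinner n d (\<lambda>xs. (v xs - w xs) - (v xs - w' xs))"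
    by (simp add: d_def)
  also have "\<dots> = 0"
    using orth[OF d] w' d unfolding qinner_diff_right[of n d "\<lambda>xs. v xs - w xs"] by simp
  finally have "d = (\<lambda>xs. 0)" using qinner_self_eq_0 d U(2) by blast
  then show "w' = w" unfolding d_def by (metis (no_types) eq_iff_diff_eq_0 ext)
qed (use assms in auto)

subsection \<open>Raising and lowering operators\<close>

text \<open>The ladder operator taking |1> to |0> at factor \<open>i\<close> and killing |0>.
  Vectors are coefficient functions, so the value at \<open>ys\<close> is read off at the string
  with bit \<open>i\<close> set.\<close>

definition site_lower :: "nat \<Rightarrow> qvec \<Rightarrow> qvec" where
  "site_lower i v = (\<lambda>ys. if i < length ys \<and> \<not> ys ! i then v (ys[i := True]) else 0)"

definition site_raise :: "nat \<Rightarrow> qvec \<Rightarrow> qvec" where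
  "site_raise i v = (\<lambda>ys. if i < length ys \<and> ys ! i then v (ys[i := False]) else 0)"

definition lower :: "nat \<Rightarrow> qvec \<Rightarrow> qvec" where
  "lower n v = (\<lambda>ys. \<Sum>i<n. site_lower i v ys)"

definition raise :: "nat \<Rightarrow> qvec \<Rightarrow> qvec" where
  "raise n v = (\<lambda>ys. \<Sum>i<n. site_raise i v ys)"

definition weight_space :: "nat \<Rightarrow> nat \<Rightarrow> qvec set" where
  "weight_space n w = {v \<in> tvecs n. \<forall>ys. v ys \<noteq> 0 \<longrightarrow> wt ys = w}"

lemma csubspace_weight_space: "csubspace (weight_space n w)"
  using csubspace_tvecs[of n] by (auto simp: csubspace_def weight_space_def) (metis add_0 mult_zero_right)

lemma weight_space_tvecs: "v \<in> weight_space n w \<Longrightarrow> v \<in> tvecs n"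
  by (simp add: weight_space_def)

lemma qinner_different_weights:
  assumes "u \<in> weight_space n w" "v \<in> weight_space n w'" "w \<noteq> w'"
  shows "qinner n u v = 0"
  unfolding qinner_def by (rule sum.neutral) (use assms in \<open>auto simp: weight_space_def\<close>)

lemma site_tvecs:
  assumes "v \<in> tvecs n"
  shows "site_raise i v \<in> tvecs n" "site_lower i v \<in> tvecs n"
  using assms by (auto simp: tvecs_def site_raise_def site_lower_def)

lemma raise_tvecs: "v \<in> tvecs n \<Longrightarrow> raise n v \<in> tvecs n"
  using site_tvecs(1)[of v n] by (auto simp: tvecs_def raise_def)

lemma lower_tvecs: "v \<in> tvecs n \<Longrightarrow> lower n v \<in> tvecs n"
  using site_tvecs(2)[of v n] by (auto simp: tvecs_def lower_def)

lemma raise_weight_space: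
  assumes "v \<in> weight_space n w"
  shows "raise n v \<in> weight_space n (Suc w)"
proof -
  have "wt ys = Suc w" if "raise n v ys \<noteq> 0" for ys
  proof -
    from that obtain i where "i < n" "site_raise i v ys \<noteq> 0"
      unfolding raise_def by (meson lessThan_iff sum.neutral)
    then have i: "i < length ys" "ys ! i" "v (ys[i := False]) \<noteq> 0"
      by (auto simp: site_raise_def split: if_splits)
    then show ?thesis
      using assms wt_update_False[OF i(1,2)] by (auto simp: weight_space_def)
  qed
  then show ?thesis
    using assms raise_tvecs by (auto simp: weight_space_def)
qed

lemma lower_weight_space:
  assumes "v \<in> weight_space n w" "lower n v ys \<noteq> 0"
  shows "Suc (wt ys) = w"
proof -
  from assms(2) obtain i where "i < n" "site_lower i v ys \<noteq> 0"
    unfolding lower_def by (meson lessThan_iff sum.neutral)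
  then have i: "i < length ys" "\<not> ys ! i" "v (ys[i := True]) \<noteq> 0"
    by (auto simp: site_lower_def split: if_splits)
  then show ?thesis
    using assms(1) wt_update_True[OF i(1,2)] by (auto simp: weight_space_def)
qed

lemma raise_pow_weight_space:
  "v \<in> weight_space n w \<Longrightarrow> (raise n ^^ j) v \<in> weight_space n (w + j)"
  by (induction j) (auto intro: raise_weight_space)

lemma raise_pow_tvecs: "v \<in> tvecs n \<Longrightarrow> (raise n ^^ j) v \<in> tvecs n"
  by (induction j) (auto intro: raise_tvecs)

lemma raise_lincomb: "raise n (\<lambda>xs. u xs + c * v xs) = (\<lambda>xs. raise n u xs + c * raise n v xs)"
  unfolding raise_def sum_distrib_left sum.distrib[symmetric]
  by (intro ext sum.cong) (auto simp: site_raise_def)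

lemma raise_pow_lincomb:
  "(raise n ^^ j) (\<lambda>xs. u xs + c * v xs) = (\<lambda>xs. (raise n ^^ j) u xs + c * (raise n ^^ j) v xs)"
  by (induction j) (simp_all add: raise_lincomb)

lemma raise_zero: "raise n (\<lambda>xs. 0) = (\<lambda>xs. 0)"
  by (auto simp: raise_def site_raise_def)

lemma raise_pow_zero: "(raise n ^^ j) (\<lambda>xs. 0) = (\<lambda>xs. 0)"
  by (induction j) (simp_all add: raise_zero)

lemma raise_scale: "raise n (\<lambda>xs. c * v xs) = (\<lambda>xs. c * raise n v xs)"
  using raise_lincomb[of n "\<lambda>xs. 0" c v] by (simp add: raise_zero)

text \<open>Flipping bit \<open>i\<close> is a bijection between the strings with and without that
  bit, which makes the two ladder operators adjoint.\<close>

lemma qinner_site_raise: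
  assumes "i < n"
  shows "qinner n (site_raise i u) v = qinner n u (site_lower i v)"
proof -
  have "qinner n (site_raise i u) v
      = (\<Sum>ys\<in>{ys. length ys = n \<and> ys ! i}. cnj (u (ys[i := False])) * v ys)"
    unfolding qinner_def
    by (rule sum.mono_neutral_cong_right) (use assms in \<open>auto simp: site_raise_def\<close>)
  also have "\<dots> = (\<Sum>ys\<in>{ys. length ys = n \<and> \<not> ys ! i}. cnj (u ys) * v (ys[i := True]))"
  proof (rule sum.reindex_bij_witness[where i = "\<lambda>ys. ys[i := True]" and j = "\<lambda>ys. ys[i := False]"])
    fix ys assume "ys \<in> {ys. length ys = n \<and> ys ! i}"
    then show "ys[i := False, i := True] = ys" using list_update_id[of ys i] by simp
    then show "cnj (u (ys[i := False])) * v (ys[i := False, i := True]) = cnj (u (ys[i := False])) * v ys"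
      by simp
  next
    fix ys assume "ys \<in> {ys. length ys = n \<and> \<not> ys ! i}"
    then show "ys[i := True, i := False] = ys" using list_update_id[of ys i] by simp
  qed (use assms in auto)
  also have "\<dots> = qinner n u (site_lower i v)"
    unfolding qinner_def
    by (rule sum.mono_neutral_cong_left) (use assms in \<open>auto simp: site_lower_def\<close>)
  finally show ?thesis .
qed

lemma qinner_raise: "qinner n (raise n u) v = qinner n u (lower n v)"
  unfolding raise_def lower_def qinner_sum_left qinner_sum_right
  by (rule sum.cong) (auto intro: qinner_site_raise)

text \<open>The relation [E,F] = H of sl2. Ladder operators at distinct sites commute; at one site
  the commutator is +1 on |0> and -1 on |1>, and summing counts zeros minus ones.\<close>

lemma lower_raise:
  assumes "length ys = n"
  shows "lower n (raise n v) ys = raise n (lower n v) ys + (of_nat n - 2 * of_nat (wt ys)) * v ys"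
proof -
  have lr: "lower n (raise n v) ys = (\<Sum>i<n. \<Sum>j<n. site_lower i (site_raise j v) ys)"
    unfolding lower_def raise_def by (rule sum.cong) (auto simp: site_lower_def)
  have rl: "raise n (lower n v) ys = (\<Sum>i<n. \<Sum>j<n. site_raise j (site_lower i v) ys)"
    unfolding lower_def raise_def
    by (subst sum.swap) (auto simp: site_raise_def intro!: sum.cong)
  have site: "site_lower i (site_raise j v) ys - site_raise j (site_lower i v) ys
      = (if i = j then (if ys ! i then - v ys else v ys) else 0)" if "i < n" "j < n" for i j
  proof -
    have "ys ! i \<Longrightarrow> ys[i := True] = ys" "\<not> ys ! i \<Longrightarrow> ys[i := False] = ys"
      using list_update_id[of ys i] by simp_all
    then show ?thesis
      using that assms by (auto simp: site_lower_def site_raise_def list_update_swap)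
  qed
  have "lower n (raise n v) ys - raise n (lower n v) ys
      = (\<Sum>i<n. \<Sum>j<n. if i = j then (if ys ! i then - v ys else v ys) else 0)"
    unfolding lr rl sum_subtractf[symmetric] by (intro sum.cong) (auto simp: site)
  also have "\<dots> = (\<Sum>i<n. (1 - 2 * of_bool (ys ! i)) * v ys)"
    by (rule sum.cong) auto
  also have "\<dots> = (of_nat n - 2 * (\<Sum>i<n. of_bool (ys ! i))) * v ys"
    by (simp add: sum_subtractf flip: sum_distrib_right sum_distrib_left)
  also have "(\<Sum>i<n. of_bool (ys ! i)) = (of_nat (wt ys) :: complex)"
  proof -
    have "{..<n} \<inter> {i. ys ! i} = {i. i < length ys \<and> ys ! i}" using assms by auto
    then show ?thesis by (simp add: sum_of_bool_eq wt_def)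
  qed
  finally show ?thesis by (simp add: algebra_simps)
qed

lemma lower_raise_weight:
  assumes "v \<in> weight_space n w"
  shows "lower n (raise n v) = (\<lambda>ys. raise n (lower n v) ys + (of_nat n - 2 * of_nat w) * v ys)"
proof (rule tvecs_eqI)
  have v: "v \<in> tvecs n" using assms by (rule weight_space_tvecs)
  then show "lower n (raise n v) \<in> tvecs n" by (intro lower_tvecs raise_tvecs)
  show "(\<lambda>ys. raise n (lower n v) ys + (of_nat n - 2 * of_nat w) * v ys) \<in> tvecs n"
    using csubspace_tvecs[of n] v raise_tvecs[OF lower_tvecs[OF v]] by (auto simp: csubspace_def)
  fix ys :: "bool list" assume ys: "length ys = n"
  show "lower n (raise n v) ys = raise n (lower n v) ys + (of_nat n - 2 * of_nat w) * v ys"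
    using lower_raise[OF ys] assms by (cases "v ys = 0") (auto simp: weight_space_def)
qed

text \<open>Commuting \<open>lower\<close> past the raisings collects n - 2(x+i) for i = 0, ..., j,
  whose sum is (j+1)(n - 2x - j).\<close>

lemma lower_raise_pow:
  assumes u: "u \<in> weight_space n x" and low: "lower n u = (\<lambda>ys. 0)"
  shows "lower n ((raise n ^^ Suc j) u)
    = (\<lambda>ys. of_nat (Suc j) * (of_nat n - 2 * of_nat x - of_nat j) * (raise n ^^ j) u ys)"
proof (induction j)
  case 0
  show ?case using lower_raise_weight[OF u] low by (simp add: raise_zero)
next
  case (Suc j)
  have "lower n ((raise n ^^ Suc (Suc j)) u) = lower n (raise n ((raise n ^^ Suc j) u))"
    by simp
  also have "\<dots> = (\<lambda>ys. raise n (lower n ((raise n ^^ Suc j) u)) ys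
      + (of_nat n - 2 * of_nat (x + Suc j)) * (raise n ^^ Suc j) u ys)"
    by (rule lower_raise_weight[OF raise_pow_weight_space[OF u]])
  also have "\<dots> = (\<lambda>ys. of_nat (Suc j) * (of_nat n - 2 * of_nat x - of_nat j) * (raise n ^^ Suc j) u ys
      + (of_nat n - 2 * of_nat (x + Suc j)) * (raise n ^^ Suc j) u ys)"
    unfolding Suc.IH raise_scale by simp
  also have "\<dots> = (\<lambda>ys. of_nat (Suc (Suc j)) * (of_nat n - 2 * of_nat x - of_nat (Suc j))
      * (raise n ^^ Suc j) u ys)"
    by (rule ext) (simp add: algebra_simps)
  finally show ?case .
qed

text \<open>The factor by which j raisings multiply the squared norm of a lowest weight vector of
  weight \<open>x\<close>: j! (n-2x)! / (n-2x-j)! while j \<le> n - 2x. For 2x \<le> n and larger j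
  the real product contains a zero factor, which is where the string of weights ends.\<close>

definition raise_norm :: "nat \<Rightarrow> nat \<Rightarrow> nat \<Rightarrow> real" where
  "raise_norm n x j = (\<Prod>i<j. real (Suc i) * (real n - 2 * real x - real i))"

lemma raise_norm_pos: "2 * x + j \<le> n \<Longrightarrow> raise_norm n x j > 0"
  unfolding raise_norm_def by (rule prod_pos) auto

lemma raise_norm_eq_0: "2 * x \<le> n \<Longrightarrow> n < 2 * x + j \<Longrightarrow> raise_norm n x j = 0"
  unfolding raise_norm_def by (rule prod_zero[OF _ bexI[of _ "n - 2 * x"]]) auto

text \<open>Each raising on the left becomes a lowering on the right, which undoes one raising up to
  the scalar of \<open>lower_raise_pow\<close>. On lowest weight vectors of one weight the powers of
  \<open>raise\<close> are thus isometries up to scale.\<close>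

lemma qinner_raise_pow:
  assumes v: "v \<in> weight_space n x" and low: "lower n v = (\<lambda>ys. 0)"
  shows "qinner n ((raise n ^^ j) u) ((raise n ^^ j) v) = of_real (raise_norm n x j) * qinner n u v"
proof (induction j)
  case (Suc j)
  have "qinner n ((raise n ^^ Suc j) u) ((raise n ^^ Suc j) v)
      = qinner n ((raise n ^^ j) u) (lower n ((raise n ^^ Suc j) v))"
    by (simp add: qinner_raise)
  also have "\<dots> = of_nat (Suc j) * (of_nat n - 2 * of_nat x - of_nat j)
      * (of_real (raise_norm n x j) * qinner n u v)"
    unfolding lower_raise_pow[OF v low] qinner_scale_right Suc.IH ..
  finally show ?case by (simp add: raise_norm_def mult_ac)
qed (simp add: raise_norm_def)

text \<open>With more raisings on the left than on the right, moving them over leaves a lowering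
  applied to \<open>v\<close> itself.\<close>

lemma raise_pow_orthogonal:
  assumes v: "v \<in> weight_space n x" and low: "lower n v = (\<lambda>ys. 0)" and "j' < j"
  shows "qinner n ((raise n ^^ j) u) ((raise n ^^ j') v) = 0"
  using \<open>j' < j\<close>
proof (induction j' arbitrary: j)
  case 0
  then obtain i where "j = Suc i" by (cases j) auto
  then show ?case by (simp add: qinner_raise low)
next
  case (Suc j')
  then obtain i where i: "j = Suc i" "j' < i" by (cases j) auto
  have "qinner n ((raise n ^^ j) u) ((raise n ^^ Suc j') v)
      = qinner n ((raise n ^^ i) u) (lower n ((raise n ^^ Suc j') v))"
    by (simp add: qinner_raise i)
  then show ?case
    using Suc.IH[OF i(2)] unfolding lower_raise_pow[OF v low] qinner_scale_right by simp
qed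

text \<open>If the total weights agree, x \<noteq> x' forces j \<noteq> j', and the side with fewer
  raisings gets annihilated.\<close>

lemma raise_pow_orthogonal_weights:
  assumes u: "u \<in> weight_space n x" "lower n u = (\<lambda>ys. 0)"
    and v: "v \<in> weight_space n x'" "lower n v = (\<lambda>ys. 0)" and "x \<noteq> x'"
  shows "qinner n ((raise n ^^ j) u) ((raise n ^^ j') v) = 0"
proof -
  consider "x + j \<noteq> x' + j'" | "j' < j" | "j < j'" using \<open>x \<noteq> x'\<close> by linarith
  then show ?thesis
  proof cases
    case 1
    then show ?thesis
      using qinner_different_weights[OF raise_pow_weight_space[OF u(1)] raise_pow_weight_space[OF v(1)]]
      by blast
  next
    case 2
    then show ?thesis by (rule raise_pow_orthogonal[OF v])
  next
    case 3
    then show ?thesis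
      using raise_pow_orthogonal[OF u 3, of v] by (subst qinner_cnj) simp
  qed
qed

subsection \<open>Permutations of the tensor factors\<close>

lemma perm_act_tvecs: "v \<in> tvecs n \<Longrightarrow> perm_act \<sigma> v \<in> tvecs n"
  by (auto simp: tvecs_def perm_act_def)

text \<open>The inverse appears because \<open>permute_list \<sigma> ys\<close> reads
  \<open>ys\<close> at \<open>\<sigma> k\<close> in position \<open>k\<close>.\<close>

lemma permute_list_update:
  assumes "\<sigma> permutes {..<length ys}"
  shows "permute_list \<sigma> (ys[i := c]) = (permute_list \<sigma> ys)[inv \<sigma> i := c]"
proof (rule nth_equalityI)
  fix k assume "k < length (permute_list \<sigma> (ys[i := c]))"
  then have k: "k < length ys" by simp
  then have "\<sigma> k < length ys" using permutes_in_image[OF assms, of k] by simp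
  moreover have "inv \<sigma> i = k \<longleftrightarrow> i = \<sigma> k" using permutes_inv_eq[OF assms] by auto
  ultimately show "permute_list \<sigma> (ys[i := c]) ! k = (permute_list \<sigma> ys)[inv \<sigma> i := c] ! k"
    using k assms by (cases "inv \<sigma> i = k") (simp_all add: permute_list_nth)
qed simp

text \<open>A permutation only relabels the sites, and \<open>raise\<close> sums over all of them;
  these are the two commuting actions of Schur-Weyl duality.\<close>

lemma raise_perm_act:
  assumes \<sigma>: "\<sigma> permutes {..<n}" and v: "v \<in> tvecs n"
  shows "raise n (perm_act \<sigma> v) = perm_act \<sigma> (raise n v)"
proof (rule tvecs_eqI)
  show "raise n (perm_act \<sigma> v) \<in> tvecs n" "perm_act \<sigma> (raise n v) \<in> tvecs n"
    using v by (auto intro: raise_tvecs perm_act_tvecs)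
  fix ys :: "bool list" assume ys: "length ys = n"
  have site: "site_raise i (perm_act \<sigma> v) ys = site_raise (inv \<sigma> i) v (permute_list \<sigma> ys)" if "i < n" for i
  proof -
    have "inv \<sigma> i < n" using permutes_in_image[OF permutes_inv[OF \<sigma>], of i] that by simp
    moreover have "\<sigma> (inv \<sigma> i) = i" using \<sigma> by (simp add: permutes_inverses)
    ultimately show ?thesis
      using that \<sigma> ys by (auto simp: site_raise_def perm_act_def permute_list_update permute_list_nth)
  qed
  have "raise n (perm_act \<sigma> v) ys = (\<Sum>i<n. site_raise (inv \<sigma> i) v (permute_list \<sigma> ys))"
    unfolding raise_def by (rule sum.cong) (auto simp: site)
  also have "\<dots> = (\<Sum>i<n. site_raise i v (permute_list \<sigma> ys))"
    by (rule sum.reindex_bij_betw) (rule permutes_imp_bij[OF permutes_inv[OF \<sigma>]])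
  finally show "raise n (perm_act \<sigma> v) ys = perm_act \<sigma> (raise n v) ys"
    by (simp add: raise_def perm_act_def)
qed

lemma lower_perm_act:
  assumes \<sigma>: "\<sigma> permutes {..<n}" and v: "v \<in> tvecs n"
  shows "lower n (perm_act \<sigma> v) = perm_act \<sigma> (lower n v)"
proof (rule tvecs_eqI)
  show "lower n (perm_act \<sigma> v) \<in> tvecs n" "perm_act \<sigma> (lower n v) \<in> tvecs n"
    using v by (auto intro: lower_tvecs perm_act_tvecs)
  fix ys :: "bool list" assume ys: "length ys = n"
  have site: "site_lower i (perm_act \<sigma> v) ys = site_lower (inv \<sigma> i) v (permute_list \<sigma> ys)" if "i < n" for i
  proof -
    have "inv \<sigma> i < n" using permutes_in_image[OF permutes_inv[OF \<sigma>], of i] that by simp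
    moreover have "\<sigma> (inv \<sigma> i) = i" using \<sigma> by (simp add: permutes_inverses)
    ultimately show ?thesis
      using that \<sigma> ys by (auto simp: site_lower_def perm_act_def permute_list_update permute_list_nth)
  qed
  have "lower n (perm_act \<sigma> v) ys = (\<Sum>i<n. site_lower (inv \<sigma> i) v (permute_list \<sigma> ys))"
    unfolding lower_def by (rule sum.cong) (auto simp: site)
  also have "\<dots> = (\<Sum>i<n. site_lower i v (permute_list \<sigma> ys))"
    by (rule sum.reindex_bij_betw) (rule permutes_imp_bij[OF permutes_inv[OF \<sigma>]])
  finally show "lower n (perm_act \<sigma> v) ys = perm_act \<sigma> (lower n v) ys"
    by (simp add: lower_def perm_act_def)
qed

lemma raise_pow_perm_act:
  assumes "\<sigma> permutes {..<n}" "v \<in> tvecs n"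
  shows "(raise n ^^ j) (perm_act \<sigma> v) = perm_act \<sigma> ((raise n ^^ j) v)"
  using assms by (induction j) (auto simp: raise_perm_act raise_pow_tvecs)

lemma qinner_perm_act:
  assumes \<sigma>: "\<sigma> permutes {..<n}"
  shows "qinner n (perm_act \<sigma> u) (perm_act \<sigma> v) = qinner n u v"
proof -
  note inv = permutes_inv[OF \<sigma>]
  have "permute_list (inv \<sigma>) (permute_list \<sigma> ys) = ys" "permute_list \<sigma> (permute_list (inv \<sigma>) ys) = ys"
    if "length ys = n" for ys :: "bool list"
    using that permute_list_compose[of "inv \<sigma>" ys \<sigma>] permute_list_compose[of \<sigma> ys "inv \<sigma>"] \<sigma> inv
    by (simp_all add: permutes_inv_o)
  then show ?thesis
    unfolding qinner_def perm_act_def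
    by (intro sum.reindex_bij_witness[where i = "permute_list (inv \<sigma>)" and j = "permute_list \<sigma>"]) auto
qed

lemma transpose_permutes: "i < n \<Longrightarrow> j < n \<Longrightarrow> transpose i j permutes {..<n}"
  by (rule permutes_swap_id) auto

subsection \<open>Polytabloids\<close>

lemma tableau_cols_iff:
  "tableau_cols n x a b \<longleftrightarrow> (\<forall>r<x. a r < n \<and> b r < n)
    \<and> (\<forall>r<x. \<forall>s<x. a r \<noteq> b s \<and> (r \<noteq> s \<longrightarrow> a r \<noteq> a s \<and> b r \<noteq> b s))"
proof -
  have "a ` {..<x} \<subseteq> {..<n} \<longleftrightarrow> (\<forall>r<x. a r < n)" "b ` {..<x} \<subseteq> {..<n} \<longleftrightarrow> (\<forall>r<x. b r < n)"
    by auto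
  moreover have "inj_on a {..<x} \<longleftrightarrow> (\<forall>r<x. \<forall>s<x. r \<noteq> s \<longrightarrow> a r \<noteq> a s)"
    "inj_on b {..<x} \<longleftrightarrow> (\<forall>r<x. \<forall>s<x. r \<noteq> s \<longrightarrow> b r \<noteq> b s)"
    unfolding inj_on_def by auto
  moreover have "a ` {..<x} \<inter> b ` {..<x} = {} \<longleftrightarrow> (\<forall>r<x. \<forall>s<x. a r \<noteq> b s)"
    by auto
  ultimately show ?thesis
    unfolding tableau_cols_def by meson
qed

lemma tableau_cols_range:
  assumes "tableau_cols n x a b" "r < x"
  shows "a r < n" "b r < n" "a r \<noteq> b r"
  using assms unfolding tableau_cols_iff by simp_all

lemma tableau_cols_other:
  assumes "tableau_cols n x a b" "r < x" "s < x" "r \<noteq> s"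
  shows "a r \<noteq> a s" "b r \<noteq> b s" "a r \<noteq> b s" "b r \<noteq> a s"
proof -
  have tab: "\<forall>r<x. \<forall>s<x. a r \<noteq> b s \<and> (r \<noteq> s \<longrightarrow> a r \<noteq> a s \<and> b r \<noteq> b s)"
    using assms(1) by (simp add: tableau_cols_iff)
  show "a r \<noteq> a s" "b r \<noteq> b s" "a r \<noteq> b s" using tab assms(2-4) by simp_all
  show "b r \<noteq> a s" using tab[rule_format, of s r] assms(2-4) by simp
qed

lemma tableau_cols_comp:
  assumes "\<sigma> permutes {..<n}" "tableau_cols n x a b"
  shows "tableau_cols n x (\<sigma> \<circ> a) (\<sigma> \<circ> b)"
proof -
  have "\<sigma> i = \<sigma> j \<longleftrightarrow> i = j" for i j using permutes_inj[OF assms(1)] by (simp add: inj_eq)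
  moreover have "\<sigma> i < n \<longleftrightarrow> i < n" for i using permutes_in_image[OF assms(1), of i] by simp
  ultimately show ?thesis
    using assms(2) unfolding tableau_cols_iff by simp
qed

lemma tableau_cols_card:
  assumes "tableau_cols n x a b"
  shows "2 * x \<le> n"
proof -
  have "card (a ` {..<x} \<union> b ` {..<x}) = x + x"
    using assms by (subst card_Un_disjoint) (auto simp: tableau_cols_def card_image)
  moreover have "card (a ` {..<x} \<union> b ` {..<x}) \<le> card {..<n}"
    using assms by (intro card_mono) (auto simp: tableau_cols_def)
  ultimately show ?thesis by simp
qed

text \<open>The entries of the first row with nothing below them.\<close>

definition tab_rest :: "nat \<Rightarrow> nat \<Rightarrow> (nat \<Rightarrow> nat) \<Rightarrow> (nat \<Rightarrow> nat) \<Rightarrow> nat set" where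
  "tab_rest n x a b = {..<n} - (a ` {..<x} \<union> b ` {..<x})"

lemma polytabloid_cong:
  assumes "\<And>r. r < x \<Longrightarrow> a r = a' r" "\<And>r. r < x \<Longrightarrow> b r = b' r"
  shows "polytabloid n x a b = polytabloid n x a' b'"
proof -
  have "a ` {..<x} = a' ` {..<x}" "b ` {..<x} = b' ` {..<x}" using assms by auto
  moreover have "(\<Prod>i<x. (if \<not> ys ! (a i) \<and> ys ! (b i) then 1
        else if ys ! (a i) \<and> \<not> ys ! (b i) then -1 else 0))
      = (\<Prod>i<x. (if \<not> ys ! (a' i) \<and> ys ! (b' i) then 1
        else if ys ! (a' i) \<and> \<not> ys ! (b' i) then -1 else 0 :: complex))" for ys
    by (rule prod.cong) (simp_all add: assms)
  ultimately show ?thesis by (simp only: polytabloid_def)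
qed

text \<open>There are infinitely many pairs of functions \<open>a\<close>, \<open>b\<close>, but
  only their restrictions to the \<open>x\<close> column indices matter.\<close>

lemma finite_polytabloids: "finite {polytabloid n x a b | a b. tableau_cols n x a b}"
proof (rule finite_subset)
  let ?E = "{..<x} \<rightarrow>\<^sub>E {..<n}"
  show "{polytabloid n x a b | a b. tableau_cols n x a b}
      \<subseteq> (\<lambda>(a, b). polytabloid n x a b) ` (?E \<times> ?E)"
  proof
    fix u assume "u \<in> {polytabloid n x a b | a b. tableau_cols n x a b}"
    then obtain a b where u: "u = polytabloid n x a b" "tableau_cols n x a b" by blast
    have "u = polytabloid n x (restrict a {..<x}) (restrict b {..<x})"
      unfolding u(1) by (rule polytabloid_cong) auto
    moreover have "(restrict a {..<x}, restrict b {..<x}) \<in> ?E \<times> ?E"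
      using u(2) by (auto simp: tableau_cols_def)
    ultimately show "u \<in> (\<lambda>(a, b). polytabloid n x a b) ` (?E \<times> ?E)"
      by (metis (no_types, lifting) case_prod_conv image_eqI)
  qed
  show "finite ((\<lambda>(a, b). polytabloid n x a b) ` (?E \<times> ?E))"
    by (intro finite_imageI finite_cartesian_product finite_PiE) auto
qed

lemma polytabloid_nonzero:
  assumes "polytabloid n x a b ys \<noteq> 0"
  shows "length ys = n" "r < x \<Longrightarrow> ys ! a r \<noteq> ys ! b r" "j \<in> tab_rest n x a b \<Longrightarrow> \<not> ys ! j"
proof -
  let ?f = "\<lambda>r. if \<not> ys ! a r \<and> ys ! b r then 1 else if ys ! a r \<and> \<not> ys ! b r then -1 else 0 :: complex"
  let ?g = "\<lambda>j. if ys ! j then 0 else 1 :: complex"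
  show len: "length ys = n" using assms by (metis polytabloid_def)
  then have "(\<Prod>r<x. ?f r) * (\<Prod>j\<in>tab_rest n x a b. ?g j) \<noteq> 0"
    using assms unfolding polytabloid_def tab_rest_def by (simp only: if_True simp_thms)
  then have "(\<Prod>r<x. ?f r) \<noteq> 0 \<and> (\<Prod>j\<in>tab_rest n x a b. ?g j) \<noteq> 0"
    by (simp only: mult_eq_0_iff de_Morgan_disj simp_thms)
  note nz = conjunct1[OF this] conjunct2[OF this]
  have fin: "finite {..<x}" "finite (tab_rest n x a b)" by (simp_all add: tab_rest_def)
  show "ys ! a r \<noteq> ys ! b r" if "r < x"
  proof
    assume "ys ! a r = ys ! b r"
    then have "(\<Prod>r<x. ?f r) = 0" by (intro prod_zero[OF fin(1)] bexI[of _ r]) (use that in auto)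
    with nz(1) show False by contradiction
  qed
  show "\<not> ys ! j" if "j \<in> tab_rest n x a b"
  proof
    assume "ys ! j"
    then have "(\<Prod>j\<in>tab_rest n x a b. ?g j) = 0" by (intro prod_zero[OF fin(2)] bexI[of _ j]) (use that in auto)
    with nz(2) show False by contradiction
  qed
qed

text \<open>Columns are disjoint, so picking from each one the entry whose bit is \<open>t\<close>
  gives distinct positions. Both values of \<open>t\<close> are wanted: True bounds the weight from
  below, False from above.\<close>

lemma tableau_cols_true_subset:
  fixes ys :: "bool list"
  assumes tab: "tableau_cols n x a b" and ys: "length ys = n" "\<forall>r<x. ys ! a r \<noteq> ys ! b r"
  shows "card ((\<lambda>r. if ys ! a r = t then a r else b r) ` {..<x}) = x"
    "(\<lambda>r. if ys ! a r = t then a r else b r) ` {..<x} \<subseteq> {i. i < n \<and> ys ! i = t}"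
proof -
  have "inj_on (\<lambda>r. if ys ! a r = t then a r else b r) {..<x}"
    using tableau_cols_other[OF tab] by (intro inj_onI) (metis lessThan_iff)
  then show "card ((\<lambda>r. if ys ! a r = t then a r else b r) ` {..<x}) = x"
    by (subst card_image) simp_all
  show "(\<lambda>r. if ys ! a r = t then a r else b r) ` {..<x} \<subseteq> {i. i < n \<and> ys ! i = t}"
  proof (rule image_subsetI)
    fix r assume "r \<in> {..<x}"
    then show "(if ys ! a r = t then a r else b r) \<in> {i. i < n \<and> ys ! i = t}"
      using tableau_cols_range[OF tab, of r] ys(2) by (cases "ys ! a r = t") auto
  qed
qed

lemma wt_column_bounds:
  assumes tab: "tableau_cols n x a b" and ys: "length ys = n" "\<forall>r<x. ys ! a r \<noteq> ys ! b r"
  shows "x \<le> wt ys" "wt ys + x \<le> n"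
proof -
  have le: "x \<le> card {i. i < n \<and> ys ! i = t}" for t
  proof -
    have "finite {i. i < n \<and> ys ! i = t}" by (rule finite_subset[of _ "{..<n}"]) auto
    from card_mono[OF this tableau_cols_true_subset(2)[of n x a b ys, OF tab ys]]
    show ?thesis unfolding tableau_cols_true_subset(1)[OF tab ys] by blast
  qed
  show "x \<le> wt ys" using le[of True] ys(1) by (simp add: wt_def)
  have "wt ys + card {i. i < n \<and> ys ! i = False} = card ({i. i < n \<and> ys ! i} \<union> {i. i < n \<and> ys ! i = False})"
    unfolding wt_def ys(1) by (rule card_Un_disjoint[symmetric]) auto
  also have "{i. i < n \<and> ys ! i} \<union> {i. i < n \<and> ys ! i = False} = {..<n}" by auto
  finally show "wt ys + x \<le> n" using le[of False] by simp
qed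

lemma polytabloid_weight_space:
  assumes tab: "tableau_cols n x a b"
  shows "polytabloid n x a b \<in> weight_space n x"
proof -
  have "wt ys = x" if nz: "polytabloid n x a b ys \<noteq> 0" for ys
  proof -
    note nz' = polytabloid_nonzero[OF nz]
    have nz: "length ys = n" "\<forall>r<x. ys ! a r \<noteq> ys ! b r" using nz'(1,2) by blast+
    let ?A = "(\<lambda>r. if ys ! a r = True then a r else b r) ` {..<x}"
    have "{i. i < length ys \<and> ys ! i} = ?A"
    proof
      show "?A \<subseteq> {i. i < length ys \<and> ys ! i}"
        using tableau_cols_true_subset(2)[OF tab nz, of True] nz(1) by auto
      show "{i. i < length ys \<and> ys ! i} \<subseteq> ?A"
      proof
        fix i assume i: "i \<in> {i. i < length ys \<and> ys ! i}"
        then have "i \<in> a ` {..<x} \<union> b ` {..<x}" using nz(1) nz'(3)[of i] by (auto simp: tab_rest_def)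
        then show "i \<in> ?A" using i nz(2) by (auto simp: image_iff)
      qed
    qed
    then show ?thesis
      using tableau_cols_true_subset(1)[OF tab nz, of True] by (simp add: wt_def)
  qed
  moreover have "polytabloid n x a b \<in> tvecs n" by (simp add: polytabloid_def tvecs_def)
  ultimately show ?thesis by (simp add: weight_space_def)
qed

lemmas polytabloid_tvecs = weight_space_tvecs[OF polytabloid_weight_space]

lemma polytabloid_neq_0:
  assumes tab: "tableau_cols n x a b"
  shows "polytabloid n x a b \<noteq> (\<lambda>ys. 0)"
proof -
  \<comment> \<open>Ones exactly on the second row: there every factor of the polytabloid equals
    1.\<close>
  define ys where "ys = map (\<lambda>i. i \<in> b ` {..<x}) [0..<n]"
  have "\<not> ys ! a r \<and> ys ! b r" if "r < x" for r
  proof -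
    have "a r \<notin> b ` {..<x}" using tab that unfolding tableau_cols_iff by blast
    then show ?thesis using tableau_cols_range[OF tab that] that by (simp add: ys_def)
  qed
  moreover have "\<not> ys ! j" if "j \<in> {..<n} - (a ` {..<x} \<union> b ` {..<x})" for j
    using that by (auto simp: ys_def)
  ultimately have "polytabloid n x a b ys = 1"
    by (simp add: polytabloid_def ys_def)
  then show ?thesis by (metis zero_neq_one)
qed

lemma perm_act_polytabloid:
  assumes \<sigma>: "\<sigma> permutes {..<n}" and tab: "tableau_cols n x a b"
  shows "perm_act \<sigma> (polytabloid n x a b) = polytabloid n x (\<sigma> \<circ> a) (\<sigma> \<circ> b)"
proof (rule ext)
  fix ys :: "bool list"
  show "perm_act \<sigma> (polytabloid n x a b) ys = polytabloid n x (\<sigma> \<circ> a) (\<sigma> \<circ> b) ys"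
  proof (cases "length ys = n")
    case True
    let ?R = "{..<n} - (a ` {..<x} \<union> b ` {..<x})"
    let ?R' = "{..<n} - ((\<sigma> \<circ> a) ` {..<x} \<union> (\<sigma> \<circ> b) ` {..<x})"
    have nth: "permute_list \<sigma> ys ! i = ys ! \<sigma> i" if "i < n" for i
      using that True \<sigma> by (simp add: permute_list_nth)
    have "bij_betw \<sigma> ?R ?R'"
    proof -
      have "\<sigma> ` ?R = \<sigma> ` {..<n} - \<sigma> ` (a ` {..<x} \<union> b ` {..<x})"
        by (rule image_set_diff) (rule permutes_inj[OF \<sigma>])
      also have "\<dots> = ?R'"
        using permutes_image[OF \<sigma>] by (simp add: image_Un image_comp)
      finally show ?thesis
        using permutes_inj_on[OF \<sigma>] by (auto simp: bij_betw_def)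
    qed
    then have "(\<Prod>j\<in>?R'. (if ys ! j then 0 else 1)) = (\<Prod>j\<in>?R. (if ys ! \<sigma> j then 0 else 1 :: complex))"
      by (rule prod.reindex_bij_betw[symmetric])
    moreover have "(\<Prod>j\<in>?R. (if permute_list \<sigma> ys ! j then 0 else 1))
        = (\<Prod>j\<in>?R. (if ys ! \<sigma> j then 0 else 1 :: complex))"
      by (rule prod.cong) (simp_all add: nth)
    moreover have "(\<Prod>i<x. (if \<not> permute_list \<sigma> ys ! (a i) \<and> permute_list \<sigma> ys ! (b i) then 1
          else if permute_list \<sigma> ys ! (a i) \<and> \<not> permute_list \<sigma> ys ! (b i) then -1 else 0))
        = (\<Prod>i<x. (if \<not> ys ! ((\<sigma> \<circ> a) i) \<and> ys ! ((\<sigma> \<circ> b) i) then 1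
          else if ys ! ((\<sigma> \<circ> a) i) \<and> \<not> ys ! ((\<sigma> \<circ> b) i) then -1 else 0 :: complex))"
      by (rule prod.cong) (simp_all add: nth tableau_cols_range[OF tab])
    ultimately show ?thesis
      by (simp only: perm_act_def polytabloid_def length_permute_list)
  qed (simp add: perm_act_def polytabloid_def)
qed

lemma polytabloid_swap_column:
  assumes "r < x"
  shows "polytabloid n x (a(r := b r)) (b(r := a r)) = (\<lambda>ys. - polytabloid n x a b ys)"
proof (rule ext)
  fix ys :: "bool list"
  have im: "(a(r := b r)) ` {..<x} \<union> (b(r := a r)) ` {..<x} = a ` {..<x} \<union> b ` {..<x}"
    using assms by (auto simp: fun_upd_def image_iff split: if_splits)
  have split: "(\<Prod>i<x. f i) = f r * (\<Prod>i\<in>{..<x} - {r}. f i)" for f :: "nat \<Rightarrow> complex"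
    by (rule prod.remove) (use assms in auto)
  show "polytabloid n x (a(r := b r)) (b(r := a r)) ys = - polytabloid n x a b ys"
  proof -
    have "(\<Prod>i\<in>{..<x} - {r}. (if \<not> ys ! ((a(r := b r)) i) \<and> ys ! ((b(r := a r)) i) then 1
          else if ys ! ((a(r := b r)) i) \<and> \<not> ys ! ((b(r := a r)) i) then -1 else 0))
        = (\<Prod>i\<in>{..<x} - {r}. (if \<not> ys ! (a i) \<and> ys ! (b i) then 1
          else if ys ! (a i) \<and> \<not> ys ! (b i) then -1 else 0 :: complex))"
      by (rule prod.cong) auto
    then show ?thesis
      unfolding polytabloid_def im split by simp
  qed
qed

text \<open>Only relations given by single transpositions are recorded. They pass through every
  equivariant map and through \<open>raise\<close> and \<open>lower\<close>, and they leave at most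
  one vector, up to scalars, in each weight.\<close>

definition tab_symmetric :: "nat \<Rightarrow> nat \<Rightarrow> (nat \<Rightarrow> nat) \<Rightarrow> (nat \<Rightarrow> nat) \<Rightarrow> qvec \<Rightarrow> bool" where
  "tab_symmetric n x a b h \<longleftrightarrow> h \<in> tvecs n
    \<and> (\<forall>r<x. perm_act (transpose (a r) (b r)) h = (\<lambda>ys. - h ys))
    \<and> (\<forall>i\<in>tab_rest n x a b. \<forall>j\<in>tab_rest n x a b. perm_act (transpose i j) h = h)"

lemma tab_symmetric_polytabloid:
  assumes tab: "tableau_cols n x a b"
  shows "tab_symmetric n x a b (polytabloid n x a b)"
  unfolding tab_symmetric_def
proof (intro conjI allI impI ballI)
  show "polytabloid n x a b \<in> tvecs n" by (rule polytabloid_tvecs[OF tab])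
next
  fix r assume r: "r < x"
  note p = transpose_permutes[OF tableau_cols_range(1,2)[OF tab r]]
  show "perm_act (transpose (a r) (b r)) (polytabloid n x a b) = (\<lambda>ys. - polytabloid n x a b ys)"
    unfolding perm_act_polytabloid[OF p tab] polytabloid_swap_column[OF r, symmetric]
  proof (rule polytabloid_cong)
    fix s assume "s < x"
    then show "(transpose (a r) (b r) \<circ> a) s = (a(r := b r)) s"
      "(transpose (a r) (b r) \<circ> b) s = (b(r := a r)) s"
      using tableau_cols_other[OF tab r, of s] tableau_cols_range[OF tab r]
      by (cases "s = r"; simp add: Transposition.transpose_def)+
  qed
next
  fix i j assume ij: "i \<in> tab_rest n x a b" "j \<in> tab_rest n x a b"
  then have p: "transpose i j permutes {..<n}" by (intro transpose_permutes) (auto simp: tab_rest_def)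
  show "perm_act (transpose i j) (polytabloid n x a b) = polytabloid n x a b"
    unfolding perm_act_polytabloid[OF p tab]
    by (rule polytabloid_cong) (use ij in \<open>auto simp: Transposition.transpose_def tab_rest_def image_iff\<close>)
qed

lemma tab_symmetric_raise:
  assumes tab: "tableau_cols n x a b" and h: "tab_symmetric n x a b h"
  shows "tab_symmetric n x a b (raise n h)"
proof -
  have tv: "h \<in> tvecs n" using h by (simp add: tab_symmetric_def)
  have neg: "raise n (\<lambda>ys. - h ys) = (\<lambda>ys. - raise n h ys)" using raise_scale[of n "-1" h] by simp
  show ?thesis
    using h tableau_cols_range[OF tab] raise_tvecs[OF tv]
    by (auto simp: tab_symmetric_def tab_rest_def neg
        simp flip: raise_perm_act[OF transpose_permutes tv])
qed

lemma tab_symmetric_lower: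
  assumes tab: "tableau_cols n x a b" and h: "tab_symmetric n x a b h"
  shows "tab_symmetric n x a b (lower n h)"
proof -
  have tv: "h \<in> tvecs n" using h by (simp add: tab_symmetric_def)
  have neg: "lower n (\<lambda>ys. - h ys) = (\<lambda>ys. - lower n h ys)"
    by (auto simp: lower_def site_lower_def simp flip: sum_negf intro!: sum.cong)
  show ?thesis
    using h tableau_cols_range[OF tab] lower_tvecs[OF tv]
    by (auto simp: tab_symmetric_def tab_rest_def neg
        simp flip: lower_perm_act[OF transpose_permutes tv])
qed

lemma tab_symmetric_raise_pow:
  "tableau_cols n x a b \<Longrightarrow> tab_symmetric n x a b h \<Longrightarrow> tab_symmetric n x a b ((raise n ^^ j) h)"
  by (induction j) (simp_all add: tab_symmetric_raise)

lemma permute_list_transpose_nth: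
  assumes "i < length ys" "j < length ys" "k < length ys"
  shows "permute_list (transpose i j) ys ! k = ys ! transpose i j k"
  by (rule permute_list_nth[OF transpose_permutes]) (fact assms)+

text \<open>The column swap fixes such a string, so the sign rule reads h(ys) = -h(ys).\<close>

lemma tab_symmetric_eq_0:
  assumes tab: "tableau_cols n x a b" and h: "tab_symmetric n x a b h"
    and r: "r < x" "ys ! a r = ys ! b r"
  shows "h ys = 0"
proof (cases "length ys = n")
  case True
  have "permute_list (transpose (a r) (b r)) ys = ys"
    using True tableau_cols_range[OF tab r(1)] r(2)
    by (intro nth_equalityI) (simp_all add: permute_list_transpose_nth Transposition.transpose_def)
  moreover have "perm_act (transpose (a r) (b r)) h ys = - h ys"
    using h r(1) by (simp add: tab_symmetric_def)
  ultimately show ?thesis by (simp add: perm_act_def)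
next
  case False
  then show ?thesis using h by (simp add: tab_symmetric_def tvecs_def)
qed

text \<open>By weight: the lowered vector keeps the column signs, so it lives on strings with at
  least \<open>x\<close> ones, while lowering leaves only x - 1.\<close>

lemma lower_polytabloid:
  assumes tab: "tableau_cols n x a b"
  shows "lower n (polytabloid n x a b) = (\<lambda>ys. 0)"
proof (rule ext, rule ccontr)
  fix ys assume nz: "lower n (polytabloid n x a b) ys \<noteq> 0"
  note sym = tab_symmetric_lower[OF tab tab_symmetric_polytabloid[OF tab]]
  have "length ys = n" using sym nz by (auto simp: tab_symmetric_def tvecs_def)
  moreover have "\<forall>r<x. ys ! a r \<noteq> ys ! b r"
    using tab_symmetric_eq_0[OF tab sym] nz by blast
  ultimately have "x \<le> wt ys" by (rule wt_column_bounds[OF tab])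
  then show False using lower_weight_space[OF polytabloid_weight_space[OF tab] nz] by simp
qed

text \<open>Descent step for an induction on Hamming distance: bits have two values, so if
  \<open>zs\<close> is wrong at both positions and has different bits there, the swap corrects
  both.\<close>

lemma card_diff_transpose:
  fixes ys zs :: "bool list"
  assumes len: "length ys = n" "length zs = n" and ij: "i < n" "j < n"
    and d: "ys ! i \<noteq> zs ! i" "ys ! j \<noteq> zs ! j" "zs ! i \<noteq> zs ! j"
  shows "card {k. k < n \<and> ys ! k \<noteq> permute_list (transpose i j) zs ! k} < card {k. k < n \<and> ys ! k \<noteq> zs ! k}"
proof (rule psubset_card_mono)
  have "k < n \<Longrightarrow> permute_list (transpose i j) zs ! k = (if k = i then zs ! j else if k = j then zs ! i else zs ! k)" for k
    using len ij by (subst permute_list_transpose_nth) (auto simp: Transposition.transpose_def)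
  then have "k \<noteq> i \<and> k \<noteq> j \<and> ys ! k \<noteq> zs ! k"
    if "k < n" "ys ! k \<noteq> permute_list (transpose i j) zs ! k" for k
    using that ij d by (cases "k = i"; cases "k = j") auto
  then show "{k. k < n \<and> ys ! k \<noteq> permute_list (transpose i j) zs ! k} \<subset> {k. k < n \<and> ys ! k \<noteq> zs ! k}"
    using ij(1) d(1) by blast
qed simp

text \<open>Swaps inside a column or outside all columns carry \<open>zs\<close> to
  \<open>ys\<close>, each changing the value by at most a sign. The scalar precedes the quantifier
  over \<open>h\<close> because the same \<open>s\<close> is later applied to a given vector and to
  the raised polytabloid it is compared with.\<close>

lemma tab_symmetric_proportional:
  assumes tab: "tableau_cols n x a b" and ys: "length ys = n" "\<And>r. r < x \<Longrightarrow> ys ! a r \<noteq> ys ! b r"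
    and "length zs = n" "\<And>r. r < x \<Longrightarrow> zs ! a r \<noteq> zs ! b r" "wt zs = wt ys"
  shows "\<exists>s :: complex. \<forall>h. tab_symmetric n x a b h \<longrightarrow> h ys = s * h zs"
  using assms(4-6)
proof (induction "card {k. k < n \<and> ys ! k \<noteq> zs ! k}" arbitrary: zs rule: less_induct)
  case less
  show ?case
  proof (cases "\<exists>r<x. ys ! a r \<noteq> zs ! a r")
    case True
    then obtain r where r: "r < x" "ys ! a r \<noteq> zs ! a r" by blast
    note ab = tableau_cols_range[OF tab r(1)]
    define zs' where "zs' = permute_list (transpose (a r) (b r)) zs"
    have nth: "k < n \<Longrightarrow> zs' ! k = (if k = a r then zs ! b r else if k = b r then zs ! a r else zs ! k)" for k
      unfolding zs'_def using less.prems(1) ab by (subst permute_list_transpose_nth) (auto simp: Transposition.transpose_def)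
    have "card {k. k < n \<and> ys ! k \<noteq> zs' ! k} < card {k. k < n \<and> ys ! k \<noteq> zs ! k}"
      unfolding zs'_def by (rule card_diff_transpose) (use ab ys less.prems r in auto)
    moreover have "length zs' = n" using less.prems(1) by (simp add: zs'_def)
    moreover have "zs' ! a t \<noteq> zs' ! b t" if t: "t < x" for t
      using tableau_cols_range[OF tab t] ab less.prems(2)[OF t] less.prems(2)[OF r(1)]
        tableau_cols_other[OF tab t r(1)]
      by (cases "t = r") (auto simp: nth)
    moreover have "wt zs' = wt ys"
      unfolding zs'_def using less.prems(1,3) wt_permute_list transpose_permutes[OF ab(1,2)] by simp
    ultimately obtain s where s: "\<And>h. tab_symmetric n x a b h \<Longrightarrow> h ys = s * h zs'"
      using less.hyps[of zs'] by blast
    have "h ys = - s * h zs" if h: "tab_symmetric n x a b h" for h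
    proof -
      have "perm_act (transpose (a r) (b r)) h zs = - h zs"
        using h r(1) by (simp add: tab_symmetric_def)
      then show ?thesis using s[OF h] by (simp add: zs'_def perm_act_def)
    qed
    then show ?thesis by blast
  next
    case False
    then have eq: "ys ! a r = zs ! a r" "ys ! b r = zs ! b r" if "r < x" for r
      using that ys(2)[OF that] less.prems(2)[OF that] by auto
    show ?thesis
    proof (cases "ys = zs")
      case True
      then show ?thesis by (intro exI[of _ 1]) simp
    next
      case False
      let ?Y = "{k. k < n \<and> ys ! k}" and ?Z = "{k. k < n \<and> zs ! k}"
      have ne: "?Y \<noteq> ?Z" using False ys(1) less.prems(1) by (auto simp: list_eq_iff_nth_eq)
      have card: "card ?Y = card ?Z" using less.prems ys(1) by (simp add: wt_def)
      \<comment> \<open>Equal weights rule out inclusion, so \<open>zs\<close> has both a missing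
        and a surplus one; they lie outside the columns, since the strings agree on those.\<close>
      have "\<not> ?Y \<subseteq> ?Z" "\<not> ?Z \<subseteq> ?Y"
        using ne card card_subset_eq[of ?Z ?Y] card_subset_eq[of ?Y ?Z] by auto
      then obtain i j where i: "i < n" "ys ! i" "\<not> zs ! i" and j: "j < n" "zs ! j" "\<not> ys ! j" by blast
      have rest: "i \<in> tab_rest n x a b" "j \<in> tab_rest n x a b"
        using i j eq by (auto simp: tab_rest_def)
      define zs' where "zs' = permute_list (transpose i j) zs"
      have nth: "k < n \<Longrightarrow> zs' ! k = (if k = i then zs ! j else if k = j then zs ! i else zs ! k)" for k
        unfolding zs'_def using less.prems(1) i j by (subst permute_list_transpose_nth) (auto simp: Transposition.transpose_def)
      have "card {k. k < n \<and> ys ! k \<noteq> zs' ! k} < card {k. k < n \<and> ys ! k \<noteq> zs ! k}"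
        unfolding zs'_def by (rule card_diff_transpose) (use i j ys less.prems in auto)
      moreover have "length zs' = n" using less.prems(1) by (simp add: zs'_def)
      moreover have "zs' ! a t \<noteq> zs' ! b t" if t: "t < x" for t
        using tableau_cols_range[OF tab t] rest less.prems(2)[OF t] t
        by (auto simp: nth tab_rest_def)
      moreover have "wt zs' = wt ys"
        unfolding zs'_def using less.prems(1,3) wt_permute_list transpose_permutes[OF i(1) j(1)] by simp
      ultimately obtain s where s: "\<And>h. tab_symmetric n x a b h \<Longrightarrow> h ys = s * h zs'"
        using less.hyps[of zs'] by blast
      have "h ys = s * h zs" if h: "tab_symmetric n x a b h" for h
      proof -
        have "perm_act (transpose i j) h zs = h zs"
          using h rest by (simp add: tab_symmetric_def)
        then show ?thesis using s[OF h] by (simp add: zs'_def perm_act_def)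
      qed
      then show ?thesis by blast
    qed
  qed
qed

text \<open>A vector with the symmetries of a tableau is a product of singlets on the columns and a
  symmetric tensor on the remaining factors, and the latter has one vector in each weight.\<close>

lemma tab_symmetric_in_span:
  assumes tab: "tableau_cols n x a b" and h: "tab_symmetric n x a b h"
  shows "h \<in> cspan (range (\<lambda>j. (raise n ^^ j) (polytabloid n x a b)))"
proof -
  define e where "e = polytabloid n x a b"
  define g where "g j = (raise n ^^ j) e" for j
  note ew = polytabloid_weight_space[OF tab, folded e_def]
  have gw: "g j \<in> weight_space n (x + j)" for j
    unfolding g_def by (rule raise_pow_weight_space[OF ew])
  have gs: "tab_symmetric n x a b (g j)" for j
    unfolding g_def e_def by (intro tab_symmetric_raise_pow tab tab_symmetric_polytabloid)
  have "\<exists>zs. g j zs \<noteq> 0" if "2 * x + j \<le> n" for j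
  proof (rule ccontr)
    assume "\<nexists>zs. g j zs \<noteq> 0"
    then have "g j = (\<lambda>xs. 0)" by auto
    then have "of_real (raise_norm n x j) * qinner n e e = 0"
      using qinner_raise_pow[OF ew, of j e] lower_polytabloid[OF tab] by (simp add: g_def e_def)
    then have "qinner n e e = 0" using raise_norm_pos[OF that] by simp
    then show False
      using polytabloid_neq_0[OF tab] qinner_self_eq_0[OF weight_space_tvecs[OF ew]] by (simp add: e_def)
  qed
  then obtain z where z: "\<And>j. 2 * x + j \<le> n \<Longrightarrow> g j (z j) \<noteq> 0" by metis
  have le: "2 * x \<le> n" by (rule tableau_cols_card[OF tab])
  \<comment> \<open>On strings of weight x + j only the j-th summand survives, so its coefficient is
    fixed by evaluating at the single string \<open>z j\<close>.\<close>
  have "h = (\<lambda>ys. \<Sum>j\<le>n - 2 * x. h (z j) / g j (z j) * g j ys)"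
  proof (rule ext)
    fix ys
    show "h ys = (\<Sum>j\<le>n - 2 * x. h (z j) / g j (z j) * g j ys)"
    proof (cases "length ys = n \<and> (\<forall>r<x. ys ! a r \<noteq> ys ! b r)")
      case False
      then have "f ys = 0" if "tab_symmetric n x a b f" for f
        using that tab_symmetric_eq_0[OF tab that, of _ ys]
        by (auto simp: tab_symmetric_def tvecs_def)
      from this[OF h] this[OF gs] show ?thesis by simp
    next
      case True
      then have bnd: "x \<le> wt ys" "wt ys + x \<le> n" using wt_column_bounds[OF tab, of ys] by auto
      define j where "j = wt ys - x"
      have j: "wt ys = x + j" "2 * x + j \<le> n" using bnd by (auto simp: j_def)
      note gz = z[OF j(2)]
      have "length (z j) = n" using gz gs[of j] by (auto simp: tab_symmetric_def tvecs_def)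
      moreover have "z j ! a r \<noteq> z j ! b r" if "r < x" for r
        using tab_symmetric_eq_0[OF tab gs that] gz by blast
      moreover have "wt (z j) = wt ys" using gz gw[of j] j by (auto simp: weight_space_def)
      ultimately obtain s where s: "\<And>f. tab_symmetric n x a b f \<Longrightarrow> f ys = s * f (z j)"
        using tab_symmetric_proportional[OF tab, of ys "z j"] True by blast
      have "(\<Sum>i\<le>n - 2 * x. h (z i) / g i (z i) * g i ys)
          = (\<Sum>i\<in>{j}. h (z i) / g i (z i) * g i ys)"
      proof (rule sum.mono_neutral_right)
        show "\<forall>i\<in>{..n - 2 * x} - {j}. h (z i) / g i (z i) * g i ys = 0"
        proof
          fix i assume "i \<in> {..n - 2 * x} - {j}"
          then have "g i ys = 0" using gw[of i] j(1) by (auto simp: weight_space_def)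
          then show "h (z i) / g i (z i) * g i ys = 0" by simp
        qed
      qed (use j le in auto)
      then show ?thesis using s[OF h] s[OF gs] gz by simp
    qed
  qed
  also have "\<dots> \<in> cspan (range g)"
    by (rule csubspace_sum[OF csubspace_cspan]) (use cspan_superset in blast)
  finally show ?thesis by (simp add: g_def e_def)
qed

subsection \<open>Completeness\<close>

text \<open>Pairing of factors \<open>p\<close> and \<open>q\<close> with the singlet |01> - |10>.
  The two freed factors are kept and set to |0> instead of being removed, so that \<open>n\<close>
  and all operators stay the same.\<close>

definition contract :: "nat \<Rightarrow> nat \<Rightarrow> qvec \<Rightarrow> qvec" where
  "contract p q v = (\<lambda>ys. if p < length ys \<and> q < length ys \<and> \<not> ys ! p \<and> \<not> ys ! q
    then v (ys[q := True]) - v (ys[p := True]) else 0)"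

lemma contract_weight_space:
  assumes "v \<in> weight_space n (Suc w)"
  shows "contract p q v \<in> weight_space n w"
proof -
  have "length ys = n \<and> wt ys = w" if "contract p q v ys \<noteq> 0" for ys
  proof -
    from that have "p < length ys" "q < length ys" "\<not> ys ! p" "\<not> ys ! q"
      and "v (ys[q := True]) \<noteq> 0 \<or> v (ys[p := True]) \<noteq> 0"
      by (auto simp: contract_def split: if_splits)
    moreover have "length zs = n \<and> wt zs = Suc w" if "v zs \<noteq> 0" for zs
      using assms that by (auto simp: weight_space_def tvecs_def)
    ultimately show ?thesis
      using wt_update_True[of p ys] wt_update_True[of q ys] by (metis length_list_update nat.inject)
  qed
  then show ?thesis by (auto simp: weight_space_def tvecs_def)
qed

text \<open>The singlet is invariant under sl2, so contracting with it preserves lowest weight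
  vectors.\<close>

lemma lower_contract:
  assumes v: "v \<in> tvecs n" and low: "lower n v = (\<lambda>ys. 0)" and pq: "p < n" "q < n" "p \<noteq> q"
  shows "lower n (contract p q v) = (\<lambda>ys. 0)"
proof (rule ext)
  fix ys :: "bool list"
  show "lower n (contract p q v) ys = 0"
  proof (cases "length ys = n \<and> \<not> ys ! p \<and> \<not> ys ! q")
    case False
    have "site_lower i (contract p q v) ys = 0" for i
      using False pq v by (auto simp: site_lower_def contract_def nth_list_update tvecs_def)
    then show ?thesis by (simp add: lower_def)
  next
    case True
    have sw: "ys[p := True, q := True] = ys[q := True, p := True]"
      using pq(3) by (rule list_update_swap)
    \<comment> \<open>For i = p or i = q the left side is 0, while the lowerings of \<open>v\<close>
      pick up its value with ones at both positions; the two corrections have opposite signs and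
      cancel in the sum.\<close>
    have site: "site_lower i (contract p q v) ys
        = site_lower i v (ys[q := True]) - site_lower i v (ys[p := True])
          + ((if i = q then v (ys[p := True, q := True]) else 0)
            - (if i = p then v (ys[p := True, q := True]) else 0))" if "i < n" for i
      using that True pq sw list_update_swap[of i p ys True True] list_update_swap[of i q ys True True]
      by (auto simp: site_lower_def contract_def nth_list_update)
    have "lower n (contract p q v) ys = lower n v (ys[q := True]) - lower n v (ys[p := True])
        + ((\<Sum>i<n. if i = q then v (ys[p := True, q := True]) else 0)
          - (\<Sum>i<n. if i = p then v (ys[p := True, q := True]) else 0))"
      unfolding lower_def sum_subtractf[symmetric] sum.distrib[symmetric]
      by (rule sum.cong) (simp_all add: site)
    then show ?thesis using low pq by simp
  qed
qed

text \<open>A new column replaces |0>|0> on two factors outside the old columns by the singlet,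
  which is the difference of the two raisings.\<close>

lemma polytabloid_Suc:
  fixes ys :: "bool list"
  assumes tab: "tableau_cols n (Suc w) a b" and len: "length ys = n"
  shows "polytabloid n (Suc w) a b ys
    = site_raise (b w) (polytabloid n w a b) ys - site_raise (a w) (polytabloid n w a b) ys"
proof -
  let ?c = "\<lambda>ys r. if \<not> ys ! a r \<and> ys ! b r then 1 else if ys ! a r \<and> \<not> ys ! b r then -1 else 0 :: complex"
  let ?d = "\<lambda>ys j. if ys ! j then 0 else 1 :: complex"
  let ?R = "{..<n} - (a ` {..<w} \<union> b ` {..<w})" and ?R' = "{..<n} - (a ` {..<Suc w} \<union> b ` {..<Suc w})"
  have w: "w < Suc w" by simp
  note ab = tableau_cols_range[OF tab w]
  note oth = tableau_cols_other[OF tab w, OF less_SucI]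
  have nin: "a w \<notin> a ` {..<w}" "a w \<notin> b ` {..<w}" "b w \<notin> a ` {..<w}" "b w \<notin> b ` {..<w}"
    using oth by fastforce+
  then have R: "?R = insert (a w) (insert (b w) ?R')"
    using ab by (auto simp: less_Suc_eq)
  have R': "a w \<notin> ?R'" "b w \<notin> ?R'" by auto
  have low: "polytabloid n w a b zs = (\<Prod>r<w. ?c ys r) * (?d zs (a w) * (?d zs (b w) * (\<Prod>j\<in>?R'. ?d ys j)))"
    if "zs = ys[k := False]" "k = a w \<or> k = b w" for zs k
  proof -
    have "(\<Prod>r<w. ?c zs r) = (\<Prod>r<w. ?c ys r)"
      using that oth by (intro prod.cong) auto
    moreover have "(\<Prod>j\<in>?R'. ?d zs j) = (\<Prod>j\<in>?R'. ?d ys j)"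
    proof (rule prod.cong)
      fix j assume "j \<in> ?R'"
      then have "j \<noteq> k" using that(2) R' by blast
      then show "?d zs j = ?d ys j" using that(1) by simp
    qed simp
    moreover have "(\<Prod>j\<in>?R. ?d zs j) = ?d zs (a w) * (?d zs (b w) * (\<Prod>j\<in>?R'. ?d zs j))"
      unfolding R using ab(3) R' by (subst prod.insert, simp, simp, subst prod.insert) simp_all
    moreover have "length zs = n" using that len by simp
    ultimately show ?thesis by (simp only: polytabloid_def if_True simp_thms)
  qed
  have "polytabloid n (Suc w) a b ys = (\<Prod>r<w. ?c ys r) * ?c ys w * (\<Prod>j\<in>?R'. ?d ys j)"
    using len by (simp only: polytabloid_def if_True simp_thms prod.lessThan_Suc)
  moreover have "site_raise (b w) (polytabloid n w a b) ys
      = (\<Prod>r<w. ?c ys r) * (if \<not> ys ! a w \<and> ys ! b w then 1 else 0) * (\<Prod>j\<in>?R'. ?d ys j)"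
    unfolding site_raise_def low[OF refl disjI2[OF refl]] using ab len by simp
  moreover have "site_raise (a w) (polytabloid n w a b) ys
      = (\<Prod>r<w. ?c ys r) * (if ys ! a w \<and> \<not> ys ! b w then 1 else 0) * (\<Prod>j\<in>?R'. ?d ys j)"
    unfolding site_raise_def low[OF refl disjI1[OF refl]] using ab len by simp
  ultimately show ?thesis by simp
qed

text \<open>The adjoint form: splitting off the last column on the left is contracting its two
  factors on the right.\<close>

lemma qinner_polytabloid_Suc:
  assumes tab: "tableau_cols n (Suc w) a b"
  shows "qinner n (polytabloid n (Suc w) a b) v = qinner n (polytabloid n w a b) (contract (a w) (b w) v)"
proof -
  note ab = tableau_cols_range[OF tab lessI]
  have rest: "a w \<in> tab_rest n w a b" "b w \<in> tab_rest n w a b"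
    using tableau_cols_other[OF tab lessI, OF less_SucI] tableau_cols_range[OF tab lessI]
    by (fastforce simp: tab_rest_def)+
  have "qinner n (polytabloid n (Suc w) a b) v
      = qinner n (\<lambda>ys. site_raise (b w) (polytabloid n w a b) ys - site_raise (a w) (polytabloid n w a b) ys) v"
    unfolding qinner_def by (rule sum.cong) (simp_all add: polytabloid_Suc[OF tab])
  also have "\<dots> = qinner n (polytabloid n w a b) (\<lambda>ys. site_lower (b w) v ys - site_lower (a w) v ys)"
    unfolding qinner_diff_left qinner_diff_right using ab by (simp add: qinner_site_raise)
  \<comment> \<open>\<open>contract\<close> also demands zeros at both positions; on all other
    strings the smaller polytabloid vanishes.\<close>
  also have "\<dots> = qinner n (polytabloid n w a b) (contract (a w) (b w) v)"
    unfolding qinner_def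
  proof (rule sum.cong)
    fix ys :: "bool list" assume "ys \<in> {ys. length ys = n}"
    then show "cnj (polytabloid n w a b ys) * (site_lower (b w) v ys - site_lower (a w) v ys)
        = cnj (polytabloid n w a b ys) * contract (a w) (b w) v ys"
      using polytabloid_nonzero(3)[OF _ rest(1), of ys] polytabloid_nonzero(3)[OF _ rest(2), of ys] ab
      by (cases "polytabloid n w a b ys = 0") (simp_all add: site_lower_def contract_def)
  qed simp
  finally show ?thesis .
qed

text \<open>If all contractions with a singlet vanish, then the vector is symmetric outside \<open>D\<close> and
  cannot be annihilated by the lowering operator unless its weight is zero.\<close>

lemma exists_contract:
  assumes v: "v \<in> weight_space n (Suc w)" and low: "lower n v = (\<lambda>ys. 0)"
    and D: "\<And>ys i. v ys \<noteq> 0 \<Longrightarrow> i \<in> D \<Longrightarrow> \<not> ys ! i" and "v \<noteq> (\<lambda>ys. 0)"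
  shows "\<exists>p q. p < n \<and> q < n \<and> p \<noteq> q \<and> p \<notin> D \<and> q \<notin> D \<and> contract p q v \<noteq> (\<lambda>ys. 0)"
proof (rule ccontr)
  assume neg: "\<nexists>p q. p < n \<and> q < n \<and> p \<noteq> q \<and> p \<notin> D \<and> q \<notin> D \<and> contract p q v \<noteq> (\<lambda>ys. 0)"
  from \<open>v \<noteq> (\<lambda>ys. 0)\<close> obtain ys where ys: "v ys \<noteq> 0" by auto
  then have len: "length ys = n" and "wt ys = Suc w" using v by (auto simp: weight_space_def tvecs_def)
  then have "{i. i < length ys \<and> ys ! i} \<noteq> {}" by (metis card.empty nat.distinct(1) wt_def)
  then obtain k where k: "k < n" "ys ! k" using len by auto
  have kD: "k \<notin> D" using D[OF ys] k by blast
  define zs where "zs = ys[k := False]"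
  have zs: "length zs = n" "\<not> zs ! k" "zs[k := True] = ys"
    using len k list_update_id[of ys k] by (simp_all add: zs_def)
  \<comment> \<open>For i in \<open>A\<close> the vanishing contraction with \<open>k\<close> gives
    v(zs[i := True]) = v(ys); for other i the term is 0. Lowering thus yields |A| v(ys), and
    \<open>k\<close> lies in \<open>A\<close>.\<close>
  define A where "A = {i. i < n \<and> i \<notin> D \<and> \<not> zs ! i}"
  have "site_lower i v zs = (if i \<in> A then v ys else 0)" if "i < n" for i
  proof (cases "i \<in> A")
    case True
    have "contract k i v zs = 0" if "i \<noteq> k"
      using neg True k kD that unfolding A_def by (metis (mono_tags, lifting) mem_Collect_eq)
    then have "v (zs[i := True]) = v ys" if "i \<noteq> k"
      using that True zs k by (simp add: contract_def A_def)
    then show ?thesis using True zs k by (cases "i = k") (auto simp: A_def site_lower_def)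
  next
    case False
    then have "zs ! i \<or> i \<in> D" using that by (auto simp: A_def)
    moreover have "v (zs[i := True]) = 0" if "i \<in> D"
      using D[of "zs[i := True]" i] that \<open>i < n\<close> zs(1) by auto
    ultimately show ?thesis using False by (auto simp: site_lower_def)
  qed
  then have "lower n v zs = (\<Sum>i<n. if i \<in> A then v ys else 0)"
    by (simp add: lower_def)
  also have "\<dots> = of_nat (card A) * v ys"
  proof -
    have "{..<n} \<inter> A = A" by (auto simp: A_def)
    then show ?thesis by (simp add: sum.If_cases Int_def[symmetric])
  qed
  finally have "card A = 0" using low ys by simp
  moreover have "k \<in> A" "finite A" using k kD zs by (auto simp: A_def)
  ultimately show False by auto
qed

text \<open>Repeated contraction supplies the columns one by one. \<open>D\<close> holds the
  positions already consumed; \<open>v\<close> has only zeros there, and this invariant keeps later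
  columns disjoint from earlier ones.\<close>

lemma exists_polytabloid_overlap:
  assumes "v \<in> weight_space n w" "lower n v = (\<lambda>ys. 0)"
    and "\<And>ys i. v ys \<noteq> 0 \<Longrightarrow> i \<in> D \<Longrightarrow> \<not> ys ! i" and "v \<noteq> (\<lambda>ys. 0)"
  shows "\<exists>a b. tableau_cols n w a b \<and> (a ` {..<w} \<union> b ` {..<w}) \<inter> D = {}
    \<and> qinner n (polytabloid n w a b) v \<noteq> 0"
  using assms
proof (induction w arbitrary: v D)
  case 0
  define zs where "zs = replicate n False"
  from \<open>v \<noteq> (\<lambda>ys. 0)\<close> obtain ys where ys: "v ys \<noteq> 0" by auto
  have eq: "xs = zs" if "v xs \<noteq> 0" for xs
  proof -
    have "length xs = n" "{i. i < length xs \<and> xs ! i} = {}"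
      using that 0(1) by (auto simp: weight_space_def tvecs_def wt_def)
    then show ?thesis unfolding zs_def by (intro nth_equalityI) auto
  qed
  have zs: "v zs \<noteq> 0" "length zs = n" using eq[OF ys] ys by (auto simp: zs_def)
  define a :: "nat \<Rightarrow> nat" where "a = (\<lambda>_. 0)"
  have "polytabloid n 0 a a zs = 1" by (simp add: polytabloid_def zs_def)
  moreover have "qinner n (polytabloid n 0 a a) v = (\<Sum>xs\<in>{zs}. cnj (polytabloid n 0 a a xs) * v xs)"
    unfolding qinner_def
  proof (rule sum.mono_neutral_right)
    show "\<forall>xs\<in>{xs. length xs = n} - {zs}. cnj (polytabloid n 0 a a xs) * v xs = 0"
      using eq by (metis DiffE insertI1 mult_zero_right)
  qed (use zs(2) in simp_all)
  ultimately have "qinner n (polytabloid n 0 a a) v \<noteq> 0" using zs by simp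
  then show ?case by (intro exI[of _ a]) (simp add: tableau_cols_def)
next
  case (Suc w)
  obtain p q where pq: "p < n" "q < n" "p \<noteq> q" "p \<notin> D" "q \<notin> D"
    and nz: "contract p q v \<noteq> (\<lambda>ys. 0)"
    using exists_contract[OF Suc.prems] by blast
  have "\<not> ys ! i" if ne: "contract p q v ys \<noteq> 0" and i: "i \<in> insert p (insert q D)" for ys i
  proof -
    have *: "p < length ys" "q < length ys" "\<not> ys ! p" "\<not> ys ! q"
      "v (ys[q := True]) \<noteq> 0 \<or> v (ys[p := True]) \<noteq> 0"
      using ne by (auto simp: contract_def split: if_splits)
    have "\<not> ys ! i" if "i \<in> D"
    proof -
      have "i \<noteq> p" "i \<noteq> q" using that pq by auto
      then show ?thesis
        using *(5) Suc.prems(3)[of "ys[q := True]" i] Suc.prems(3)[of "ys[p := True]" i] that by auto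
    qed
    then show ?thesis using i * by auto
  qed
  then obtain a b where ab: "tableau_cols n w a b"
    "(a ` {..<w} \<union> b ` {..<w}) \<inter> insert p (insert q D) = {}"
    "qinner n (polytabloid n w a b) (contract p q v) \<noteq> 0"
    using Suc.IH[OF contract_weight_space[OF Suc.prems(1)]
        lower_contract[OF weight_space_tvecs[OF Suc.prems(1)] Suc.prems(2) pq(1-3)], of "insert p (insert q D)"] nz
    by blast
  define a' b' where "a' = a(w := p)" and "b' = b(w := q)"
  have old: "r < w \<Longrightarrow> a' r = a r" "r < w \<Longrightarrow> b' r = b r" for r by (simp_all add: a'_def b'_def)
  have im: "a' ` {..<Suc w} = insert p (a ` {..<w})" "b' ` {..<Suc w} = insert q (b ` {..<w})"
    by (auto simp: a'_def b'_def lessThan_Suc)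
  have nin: "r < w \<Longrightarrow> a r \<noteq> p \<and> a r \<noteq> q \<and> b r \<noteq> p \<and> b r \<noteq> q" for r
    using ab(2) by blast
  have tab: "tableau_cols n (Suc w) a' b'"
    unfolding tableau_cols_iff
  proof (intro conjI allI impI)
    fix r assume "r < Suc w"
    then show "a' r < n" "b' r < n"
      using pq tableau_cols_range[OF ab(1), of r] by (auto simp: a'_def b'_def)
    fix s assume "s < Suc w"
    with \<open>r < Suc w\<close> show "a' r \<noteq> b' s"
      using pq(3) nin[of r] nin[of s] tableau_cols_range[OF ab(1), of r] tableau_cols_other[OF ab(1), of r s]
      by (cases "r = s") (auto simp: a'_def b'_def)
    assume "r \<noteq> s"
    with \<open>r < Suc w\<close> \<open>s < Suc w\<close> show "a' r \<noteq> a' s" "b' r \<noteq> b' s"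
      using nin[of r] nin[of s] tableau_cols_other[OF ab(1), of r s] by (auto simp: a'_def b'_def)
  qed
  have "(a' ` {..<Suc w} \<union> b' ` {..<Suc w}) \<inter> D = {}"
    unfolding im using ab(2) pq by blast
  moreover have "qinner n (polytabloid n (Suc w) a' b') v \<noteq> 0"
    unfolding qinner_polytabloid_Suc[OF tab]
    using ab(3) polytabloid_cong[of w a' a b' b n] old by (simp add: a'_def b'_def)
  ultimately show ?case using tab by blast
qed

text \<open>Moving one raising to the other side shows that \<open>lower n v\<close> inherits the
  orthogonality, so by induction it is 0. Then \<open>v\<close> is a lowest weight vector and, if
  nonzero, overlaps some unraised polytabloid of weight \<open>m\<close>.\<close>

lemma completeness:
  assumes "v \<in> weight_space n m"
    and "\<And>x a b. x \<le> m \<Longrightarrow> tableau_cols n x a b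
      \<Longrightarrow> qinner n ((raise n ^^ (m - x)) (polytabloid n x a b)) v = 0"
  shows "v = (\<lambda>ys. 0)"
  using assms
proof (induction m arbitrary: v)
  case 0
  have "lower n v = (\<lambda>ys. 0)" using lower_weight_space[OF 0(1)] by blast
  then show ?case
    using exists_polytabloid_overlap[OF 0(1), of "{}"] 0(2)[of 0] by auto
next
  case (Suc m)
  have "lower n v \<in> weight_space n m"
    using lower_weight_space[OF Suc.prems(1)] lower_tvecs[OF weight_space_tvecs[OF Suc.prems(1)]]
    by (auto simp: weight_space_def)
  moreover have "qinner n ((raise n ^^ (m - x)) (polytabloid n x a b)) (lower n v) = 0"
    if "x \<le> m" "tableau_cols n x a b" for x a b
    using Suc.prems(2)[of x a b] that by (simp add: Suc_diff_le flip: qinner_raise)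
  ultimately have "lower n v = (\<lambda>ys. 0)" by (rule Suc.IH)
  then show ?case
    using exists_polytabloid_overlap[OF Suc.prems(1), of "{}"] Suc.prems(2)[of "Suc m"] by auto
qed

subsection \<open>Isotypic components\<close>

definition raised_polytabloids :: "nat \<Rightarrow> nat \<Rightarrow> qvec set" where
  "raised_polytabloids n x = {(raise n ^^ j) (polytabloid n x a b) | j a b. tableau_cols n x a b}"

lemma specht_subset:
  "specht n x \<subseteq> weight_space n x \<inter> {v. lower n v = (\<lambda>ys. 0)}"
  unfolding specht_def
proof (rule cspan_minimal)
  have "lower n (\<lambda>xs. u xs + c * v xs) = (\<lambda>xs. lower n u xs + c * lower n v xs)" for u v c
    unfolding lower_def sum_distrib_left sum.distrib[symmetric]
    by (intro ext sum.cong) (auto simp: site_lower_def)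
  moreover have "lower n (\<lambda>xs. 0) = (\<lambda>xs. 0)" by (auto simp: lower_def site_lower_def)
  ultimately show "csubspace (weight_space n x \<inter> {v. lower n v = (\<lambda>ys. 0)})"
    using csubspace_weight_space[of n x] by (auto simp: csubspace_def)
qed (auto intro: polytabloid_weight_space lower_polytabloid)

lemma csubspace_specht: "csubspace (specht n x)"
  unfolding specht_def by (rule csubspace_cspan)

lemma polytabloid_in_specht: "tableau_cols n x a b \<Longrightarrow> polytabloid n x a b \<in> specht n x"
  unfolding specht_def by (rule subsetD[OF cspan_superset]) blast

lemma equivariant_map_raise_pow: "equivariant_map n x (raise n ^^ j)"
proof -
  have tv: "u \<in> tvecs n" if "u \<in> specht n x" for u
    using that specht_subset weight_space_tvecs by blast
  show ?thesis
    unfolding equivariant_map_def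
  proof (intro conjI ballI allI impI)
    fix u assume u: "u \<in> specht n x"
    show "(raise n ^^ j) u \<in> tvecs n" using raise_pow_tvecs[OF tv[OF u]] .
    show "(raise n ^^ j) (\<lambda>xs. u xs + v xs) = (\<lambda>xs. (raise n ^^ j) u xs + (raise n ^^ j) v xs)" for v
      using raise_pow_lincomb[where c = 1] by simp
    show "(raise n ^^ j) (\<lambda>xs. c * u xs) = (\<lambda>xs. c * (raise n ^^ j) u xs)" for c
      using raise_pow_lincomb[of j n "\<lambda>xs. 0" c u] by (simp add: raise_pow_zero)
    show "(raise n ^^ j) (perm_act \<sigma> u) = perm_act \<sigma> ((raise n ^^ j) u)" if "\<sigma> permutes {..<n}" for \<sigma>
      by (rule raise_pow_perm_act[OF that tv[OF u]])
  qed
qed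

text \<open>The tableau symmetries are equations between vectors of the Specht module, so an
  equivariant linear map preserves them.\<close>

lemma equivariant_map_polytabloid:
  assumes f: "equivariant_map n x f" and tab: "tableau_cols n x a b"
  shows "tab_symmetric n x a b (f (polytabloid n x a b))"
proof -
  let ?e = "polytabloid n x a b"
  have e: "?e \<in> specht n x" by (rule polytabloid_in_specht[OF tab])
  have sym: "tab_symmetric n x a b ?e" by (rule tab_symmetric_polytabloid[OF tab])
  have perm: "perm_act \<sigma> (f ?e) = f (perm_act \<sigma> ?e)" if "\<sigma> permutes {..<n}" for \<sigma>
    using f e that unfolding equivariant_map_def by metis
  have neg: "f (\<lambda>ys. - ?e ys) = (\<lambda>ys. - f ?e ys)"
  proof -
    have "f (\<lambda>xs. (-1) * ?e xs) = (\<lambda>xs. (-1) * f ?e xs)"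
      using f e unfolding equivariant_map_def by blast
    then show ?thesis by simp
  qed
  have tr: "\<sigma> permutes {..<n} \<Longrightarrow> perm_act \<sigma> ?e = ?e \<Longrightarrow> perm_act \<sigma> (f ?e) = f ?e" for \<sigma>
    by (simp add: perm)
  show ?thesis
    unfolding tab_symmetric_def
  proof (intro conjI allI ballI impI)
    show "f ?e \<in> tvecs n" using f e unfolding equivariant_map_def by blast
  next
    fix r assume r: "r < x"
    have p: "transpose (a r) (b r) permutes {..<n}"
      using tableau_cols_range[OF tab r] by (intro transpose_permutes)
    have "perm_act (transpose (a r) (b r)) ?e = (\<lambda>ys. - ?e ys)"
      using sym r by (simp add: tab_symmetric_def)
    then show "perm_act (transpose (a r) (b r)) (f ?e) = (\<lambda>ys. - f ?e ys)"
      by (simp only: perm[OF p] neg)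
  next
    fix i j assume ij: "i \<in> tab_rest n x a b" "j \<in> tab_rest n x a b"
    then have "transpose i j permutes {..<n}" by (intro transpose_permutes) (auto simp: tab_rest_def)
    moreover have "perm_act (transpose i j) ?e = ?e"
      using sym ij by (simp add: tab_symmetric_def)
    ultimately show "perm_act (transpose i j) (f ?e) = f ?e" by (rule tr)
  qed
qed

lemma csubspace_isotypic: "csubspace (isotypic n x)"
  unfolding isotypic_def by (rule csubspace_cspan)

lemma raise_pow_specht_in_isotypic:
  assumes "u \<in> specht n x"
  shows "(raise n ^^ j) u \<in> isotypic n x"
proof -
  let ?I = "{f ` specht n x | f. equivariant_map n x f}"
  have "(raise n ^^ j) ` specht n x \<in> ?I" using equivariant_map_raise_pow[of n x j] by blast
  then have "(raise n ^^ j) u \<in> \<Union> ?I" by (rule UnionI) (rule imageI[OF assms])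
  then show ?thesis unfolding isotypic_def by (rule subsetD[OF cspan_superset])
qed

text \<open>Trades the quantifier over maps for an explicit spanning set: powers of
  \<open>raise\<close> are themselves equivariant, and any equivariant image of a polytabloid lies
  in the span of its raised versions.\<close>

lemma isotypic_eq: "isotypic n x = cspan (raised_polytabloids n x)"
proof
  have "f ` specht n x \<subseteq> cspan (raised_polytabloids n x)" if f: "equivariant_map n x f" for f
  proof -
    \<comment> \<open>\<open>f\<close> is linear only on the Specht module, so the closure argument
      runs inside that module.\<close>
    let ?T = "{u \<in> specht n x. f u \<in> cspan (raised_polytabloids n x)}"
    have sp: "(\<lambda>xs. c * v xs) \<in> specht n x" if "v \<in> specht n x" for c v
      using csubspace_scale[OF csubspace_specht that] .
    have lin: "f (\<lambda>xs. u xs + c * v xs) = (\<lambda>xs. f u xs + c * f v xs)"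
      if "u \<in> specht n x" "v \<in> specht n x" for u v c
    proof -
      have "f (\<lambda>xs. u xs + w xs) = (\<lambda>xs. f u xs + f w xs)" if "w \<in> specht n x" for w
        using f \<open>u \<in> specht n x\<close> that unfolding equivariant_map_def by blast
      from this[OF sp[OF that(2)]]
      have "f (\<lambda>xs. u xs + c * v xs) = (\<lambda>xs. f u xs + f (\<lambda>xs. c * v xs) xs)" .
      moreover have "f (\<lambda>xs. c * v xs) = (\<lambda>xs. c * f v xs)"
        using f that(2) unfolding equivariant_map_def by blast
      ultimately show ?thesis by simp
    qed
    have zero: "(\<lambda>xs. 0) \<in> specht n x" using csubspace_specht by (simp add: csubspace_def)
    have fzero: "f (\<lambda>xs. 0) = (\<lambda>xs. 0)" using lin[OF zero zero, of "-1"] by simp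
    have "csubspace ?T"
      using csubspace_specht[of n x] csubspace_cspan[of "raised_polytabloids n x"] fzero lin
      unfolding csubspace_def by simp
    moreover have "{polytabloid n x a b | a b. tableau_cols n x a b} \<subseteq> ?T"
    proof clarify
      fix a b assume tab: "tableau_cols n x a b"
      have "cspan (range (\<lambda>j. (raise n ^^ j) (polytabloid n x a b))) \<subseteq> cspan (raised_polytabloids n x)"
        by (rule cspan_minimal[OF csubspace_cspan])
          (use cspan_superset[of "raised_polytabloids n x"] tab in \<open>auto simp: raised_polytabloids_def\<close>)
      then show "polytabloid n x a b \<in> specht n x \<and> f (polytabloid n x a b) \<in> cspan (raised_polytabloids n x)"
        using tab_symmetric_in_span[OF tab equivariant_map_polytabloid[OF f tab]]
          polytabloid_in_specht[OF tab] by blast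
    qed
    ultimately have "specht n x \<subseteq> ?T" unfolding specht_def by (rule cspan_minimal)
    then show ?thesis by blast
  qed
  then show "isotypic n x \<subseteq> cspan (raised_polytabloids n x)"
    unfolding isotypic_def by (intro cspan_minimal csubspace_cspan) blast
  show "cspan (raised_polytabloids n x) \<subseteq> isotypic n x"
    by (intro cspan_minimal csubspace_isotypic)
      (auto simp: raised_polytabloids_def intro: raise_pow_specht_in_isotypic polytabloid_in_specht)
qed

lemma isotypic_tvecs: "isotypic n x \<subseteq> tvecs n"
  unfolding isotypic_eq
  by (rule cspan_minimal[OF csubspace_tvecs])
    (auto simp: raised_polytabloids_def intro: raise_pow_tvecs polytabloid_tvecs)

subsection \<open>Projections of basis vectors\<close>

lemma specht_basis_exists:
  "\<exists>B. finite B \<and> B \<subseteq> specht n x \<and> orthonormal n B \<and> (\<forall>s\<in>specht n x. proj_onto n B s = s)"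
proof -
  let ?S = "{polytabloid n x a b | a b. tableau_cols n x a b}"
  have "?S \<subseteq> tvecs n" using polytabloid_tvecs by blast
  from exists_orthonormal[OF finite_polytabloids this] obtain B where
    B: "finite B" "B \<subseteq> cspan ?S" "orthonormal n B" "\<forall>s\<in>?S. proj_onto n B s = s" by blast
  have "proj_onto n B s = s" if "s \<in> cspan ?S" for s
    by (rule proj_onto_cspan[OF _ that]) (use B(4) in blast)
  then show ?thesis unfolding specht_def using B by blast
qed

text \<open>One orthonormal basis is fixed for each \<open>n\<close> and \<open>x\<close>; its
  cardinality is the dimension d(x).\<close>

definition specht_basis :: "nat \<Rightarrow> nat \<Rightarrow> qvec set" where
  "specht_basis n x = (SOME B. finite B \<and> B \<subseteq> specht n x \<and> orthonormal n B
    \<and> (\<forall>s\<in>specht n x. proj_onto n B s = s))"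

lemma
  shows finite_specht_basis: "finite (specht_basis n x)"
    and specht_basis_subset: "specht_basis n x \<subseteq> specht n x"
    and orthonormal_specht_basis: "orthonormal n (specht_basis n x)"
    and proj_onto_specht_basis: "s \<in> specht n x \<Longrightarrow> proj_onto n (specht_basis n x) s = s"
  using someI_ex[OF specht_basis_exists[of n x]] unfolding specht_basis_def[symmetric] by blast+

text \<open>For x \<le> m \<le> n - x the raised basis vectors form an orthogonal basis of the
  weight \<open>m\<close> slice of the component. Their common squared norm is
  \<open>raise_norm\<close>, hence the division by it.\<close>

definition iso_proj :: "nat \<Rightarrow> nat \<Rightarrow> nat \<Rightarrow> qvec \<Rightarrow> qvec" where
  "iso_proj n x m v = (\<lambda>ys. \<Sum>b\<in>specht_basis n x.
    (qinner n ((raise n ^^ (m - x)) b) v / of_real (raise_norm n x (m - x))) * (raise n ^^ (m - x)) b ys)"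

lemma specht_weight_space: "u \<in> specht n x \<Longrightarrow> u \<in> weight_space n x"
  and lower_specht: "u \<in> specht n x \<Longrightarrow> lower n u = (\<lambda>ys. 0)"
  using specht_subset by blast+

lemma iso_proj_weight_space:
  assumes "x \<le> m"
  shows "iso_proj n x m v \<in> weight_space n m"
proof -
  have "(raise n ^^ (m - x)) b \<in> weight_space n m" if "b \<in> specht_basis n x" for b
    using raise_pow_weight_space[OF specht_weight_space, of b n x "m - x"] that specht_basis_subset[of n x] assms
    by auto
  then show ?thesis
    unfolding iso_proj_def by (intro csubspace_sum[OF csubspace_weight_space])
qed

lemma iso_proj_isotypic: "iso_proj n x m v \<in> isotypic n x"
  unfolding iso_proj_def
  by (intro csubspace_sum[OF csubspace_isotypic] raise_pow_specht_in_isotypic)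
    (use specht_basis_subset in blast)

lemma qinner_iso_proj_basis:
  assumes "x \<le> m" "x + m \<le> n" and b: "b \<in> specht_basis n x"
  shows "qinner n ((raise n ^^ (m - x)) b) (iso_proj n x m v) = qinner n ((raise n ^^ (m - x)) b) v"
proof -
  define j where "j = m - x"
  have c: "raise_norm n x j > 0" using assms by (intro raise_norm_pos) (simp add: j_def)
  have in_sp: "b' \<in> specht n x" if "b' \<in> specht_basis n x" for b'
    using that specht_basis_subset by blast
  have inner: "qinner n ((raise n ^^ j) b) ((raise n ^^ j) b') = (if b = b' then of_real (raise_norm n x j) else 0)"
    if "b' \<in> specht_basis n x" for b'
    using qinner_raise_pow[OF specht_weight_space lower_specht, OF in_sp in_sp, OF that that, of j b]
      orthonormal_specht_basis[of n x] b that by (simp add: orthonormal_def)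
  have "qinner n ((raise n ^^ j) b) (iso_proj n x m v)
      = (\<Sum>b'\<in>specht_basis n x. qinner n ((raise n ^^ j) b') v / of_real (raise_norm n x j)
          * qinner n ((raise n ^^ j) b) ((raise n ^^ j) b'))"
    unfolding iso_proj_def j_def[symmetric] qinner_sum_right qinner_scale_right ..
  also have "\<dots> = (\<Sum>b'\<in>specht_basis n x. if b = b' then qinner n ((raise n ^^ j) b') v else 0)"
    by (rule sum.cong) (use c in \<open>simp_all add: inner\<close>)
  also have "\<dots> = qinner n ((raise n ^^ j) b) v"
    using b finite_specht_basis[of n x] by simp
  finally show ?thesis by (simp add: j_def)
qed

lemma iso_proj_orthogonal:
  assumes "x \<le> m" "x + m \<le> n" and s: "s \<in> specht n x"
  shows "qinner n ((raise n ^^ (m - x)) s) (\<lambda>ys. v ys - iso_proj n x m v ys) = 0"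
proof -
  define j where "j = m - x"
  define y where "y = (\<lambda>ys. v ys - iso_proj n x m v ys)"
  let ?T = "{u. qinner n ((raise n ^^ j) u) y = 0}"
  have "csubspace ?T"
    unfolding csubspace_def
    by (auto simp: raise_pow_zero raise_pow_lincomb qinner_def sum.distrib algebra_simps
        simp flip: sum_distrib_left)
  moreover have "b \<in> ?T" if "b \<in> specht_basis n x" for b
    using qinner_iso_proj_basis[OF assms(1,2) that] by (simp add: y_def qinner_diff_right j_def)
  ultimately have "proj_onto n (specht_basis n x) s \<in> ?T"
    unfolding proj_onto_def by (intro csubspace_sum)
  then show ?thesis using proj_onto_specht_basis[OF s] by (simp add: j_def y_def)
qed

text \<open>Raised polytabloids of weight other than \<open>m\<close> are orthogonal to everything
  of weight \<open>m\<close>, and those of weight above n - x have norm 0, so only the weight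
  \<open>m\<close> slice of the component counts.\<close>

lemma
  assumes v: "v \<in> weight_space n m"
  shows orth_proj_isotypic:
      "orth_proj n (isotypic n x) v = (if x \<le> m \<and> x + m \<le> n then iso_proj n x m v else (\<lambda>ys. 0))"
      (is "_ = ?w")
    and orth_proj_isotypic_orthogonal:
      "u \<in> isotypic n x \<Longrightarrow> qinner n u (\<lambda>ys. v ys - orth_proj n (isotypic n x) v ys) = 0"
proof -
  have w_in: "?w \<in> isotypic n x"
    using csubspace_isotypic iso_proj_isotypic by (simp add: csubspace_def)
  have w: "?w \<in> weight_space n m"
    using csubspace_weight_space[of n m] iso_proj_weight_space by (simp add: csubspace_def)
  have vw: "(\<lambda>ys. v ys - ?w ys) \<in> weight_space n m"
    by (rule csubspace_diff[OF csubspace_weight_space v w])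
  have orth: "qinner n u (\<lambda>ys. v ys - ?w ys) = 0" if "u \<in> isotypic n x" for u
    using that unfolding isotypic_eq
  proof (rule orthogonal_cspan[rotated])
    fix s assume "s \<in> raised_polytabloids n x"
    then obtain j a b where tab: "tableau_cols n x a b" and s: "s = (raise n ^^ j) (polytabloid n x a b)"
      unfolding raised_polytabloids_def by blast
    note e = polytabloid_weight_space[OF tab]
    have sw: "s \<in> weight_space n (x + j)" unfolding s by (rule raise_pow_weight_space[OF e])
    consider "x + j \<noteq> m" | "x + j = m" "x + m \<le> n" | "x + j = m" "n < x + m" by linarith
    then show "qinner n s (\<lambda>ys. v ys - ?w ys) = 0"
    proof cases
      case 1
      then show ?thesis by (rule qinner_different_weights[OF sw vw])
    next
      case 2
      then show ?thesis
        using iso_proj_orthogonal[of x m n "polytabloid n x a b" v] polytabloid_in_specht[OF tab]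
        by (auto simp: s)
    next
      case 3
      then have "raise_norm n x j = 0"
        using tableau_cols_card[OF tab] by (intro raise_norm_eq_0) auto
      then have "qinner n s s = 0"
        unfolding s using qinner_raise_pow[OF e lower_polytabloid[OF tab]] by simp
      then have "s = (\<lambda>ys. 0)" by (rule qinner_self_eq_0[OF weight_space_tvecs[OF sw]])
      then show ?thesis by (simp add: qinner_def)
    qed
  qed
  show eq: "orth_proj n (isotypic n x) v = ?w"
    by (rule orth_proj_eqI[OF csubspace_isotypic isotypic_tvecs w_in orth])
  show "qinner n u (\<lambda>ys. v ys - orth_proj n (isotypic n x) v ys) = 0" if "u \<in> isotypic n x"
    unfolding eq by (rule orth[OF that])
qed

section \<open>Diagonal entries of the projections\<close>

definition ket :: "bool list \<Rightarrow> qvec" where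
  "ket I = (\<lambda>ys. if ys = I then 1 else 0)"

lemma ket_weight_space: "length I = n \<Longrightarrow> wt I = m \<Longrightarrow> ket I \<in> weight_space n m"
  by (auto simp: ket_def weight_space_def tvecs_def)

lemma qinner_ket: "length I = n \<Longrightarrow> qinner n (ket I) v = v I"
  unfolding qinner_def
  by (subst sum.remove[of _ I]) (auto simp: ket_def intro!: sum.neutral)

definition proj_diag :: "nat \<Rightarrow> nat \<Rightarrow> bool list \<Rightarrow> real" where
  "proj_diag n x I = Re (qinner n (ket I) (orth_proj n (isotypic n x) (ket I)))"

lemma proj_diag_eq:
  assumes I: "length I = n" "wt I = m" and x: "x \<le> m" "x + m \<le> n"
  shows "proj_diag n x I
    = (\<Sum>b\<in>specht_basis n x. (norm ((raise n ^^ (m - x)) b I))\<^sup>2 / raise_norm n x (m - x))"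
proof -
  define c where "c = raise_norm n x (m - x)"
  define g where "g b = (raise n ^^ (m - x)) b I" for b
  have "qinner n ((raise n ^^ (m - x)) b) (ket I) = cnj (g b)" for b
    by (subst qinner_cnj) (simp add: qinner_ket[OF I(1)] g_def)
  then have "qinner n (ket I) (orth_proj n (isotypic n x) (ket I))
      = (\<Sum>b\<in>specht_basis n x. cnj (g b) / of_real c * g b)"
    using x by (simp add: orth_proj_isotypic[OF ket_weight_space[OF I]] qinner_ket[OF I(1)] iso_proj_def c_def g_def)
  also have "\<dots> = (\<Sum>b\<in>specht_basis n x. of_real ((norm (g b))\<^sup>2 / c))"
    by (rule sum.cong) (simp_all add: complex_norm_square mult.commute del: of_real_power)
  finally show ?thesis by (simp add: proj_diag_def c_def g_def)
qed

text \<open>A trace: each orthogonal basis vector of the weight \<open>m\<close> slice contributes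
  its normalised squared norm, that is 1.\<close>

lemma sum_proj_diag:
  assumes x: "x \<le> m" "x + m \<le> n"
  shows "(\<Sum>I\<in>{I. length I = n \<and> wt I = m}. proj_diag n x I) = real (card (specht_basis n x))"
proof -
  define j where "j = m - x"
  define c where "c = raise_norm n x j"
  have c: "c > 0" unfolding c_def using x by (intro raise_norm_pos) (simp add: j_def)
  have norm1: "(\<Sum>I\<in>{I. length I = n \<and> wt I = m}. (norm ((raise n ^^ j) b I))\<^sup>2) = c"
    if b: "b \<in> specht_basis n x" for b
  proof -
    have sp: "b \<in> specht n x" using b specht_basis_subset by blast
    have w: "(raise n ^^ j) b \<in> weight_space n m"
      using raise_pow_weight_space[OF specht_weight_space[OF sp], of j] x by (simp add: j_def)
    have "complex_of_real (\<Sum>I\<in>{I. length I = n \<and> wt I = m}. (norm ((raise n ^^ j) b I))\<^sup>2)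
        = complex_of_real (\<Sum>I\<in>{I. length I = n}. (norm ((raise n ^^ j) b I))\<^sup>2)"
      unfolding of_real_eq_iff
      by (rule sum.mono_neutral_left) (use w in \<open>auto simp: weight_space_def\<close>)
    also have "\<dots> = qinner n ((raise n ^^ j) b) ((raise n ^^ j) b)" by (rule qinner_self[symmetric])
    also have "\<dots> = complex_of_real c"
      using qinner_raise_pow[OF specht_weight_space[OF sp] lower_specht[OF sp], of j b]
        orthonormal_specht_basis[of n x] b by (simp add: orthonormal_def c_def)
    finally show ?thesis unfolding of_real_eq_iff .
  qed
  have "(\<Sum>I\<in>{I. length I = n \<and> wt I = m}. proj_diag n x I)
      = (\<Sum>I\<in>{I. length I = n \<and> wt I = m}. \<Sum>b\<in>specht_basis n x. (norm ((raise n ^^ j) b I))\<^sup>2 / c)"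
    by (rule sum.cong) (use x in \<open>auto simp: proj_diag_eq j_def c_def\<close>)
  also have "\<dots> = (\<Sum>b\<in>specht_basis n x. (\<Sum>I\<in>{I. length I = n \<and> wt I = m}. (norm ((raise n ^^ j) b I))\<^sup>2) / c)"
    by (subst sum.swap) (simp add: sum_divide_distrib)
  also have "\<dots> = (\<Sum>b\<in>specht_basis n x. 1)"
    by (rule sum.cong) (use c norm1 in auto)
  finally show ?thesis by simp
qed

lemma perm_act_isotypic:
  assumes \<sigma>: "\<sigma> permutes {..<n}" and u: "u \<in> isotypic n x"
  shows "perm_act \<sigma> u \<in> isotypic n x"
proof -
  let ?T = "{u. perm_act \<sigma> u \<in> isotypic n x}"
  have "csubspace ?T"
    using csubspace_isotypic[of n x] by (simp add: csubspace_def perm_act_def)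
  moreover have "raised_polytabloids n x \<subseteq> ?T"
  proof
    fix s assume "s \<in> raised_polytabloids n x"
    then obtain j a b where tab: "tableau_cols n x a b" and s: "s = (raise n ^^ j) (polytabloid n x a b)"
      unfolding raised_polytabloids_def by blast
    have "perm_act \<sigma> s = (raise n ^^ j) (polytabloid n x (\<sigma> \<circ> a) (\<sigma> \<circ> b))"
      unfolding s perm_act_polytabloid[OF \<sigma> tab, symmetric]
      by (rule raise_pow_perm_act[OF \<sigma> polytabloid_tvecs[OF tab], symmetric])
    then show "s \<in> ?T"
      using raise_pow_specht_in_isotypic[OF polytabloid_in_specht[OF tableau_cols_comp[OF \<sigma> tab]]] by simp
  qed
  ultimately show ?thesis using cspan_minimal u unfolding isotypic_eq[of n x] by blast
qed

lemma permute_list_inv: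
  assumes "\<sigma> permutes {..<length ys}"
  shows "permute_list (inv \<sigma>) (permute_list \<sigma> ys) = ys" "permute_list \<sigma> (permute_list (inv \<sigma>) ys) = ys"
  using permute_list_compose[OF permutes_inv[OF assms], of \<sigma>] permute_list_compose[OF assms, of "inv \<sigma>"]
    permutes_inv_o[OF assms] by simp_all

text \<open>The component is invariant and permutations are unitary, so a test vector can be pulled
  back by \<open>inv \<sigma>\<close>.\<close>

lemma orth_proj_perm_act:
  assumes \<sigma>: "\<sigma> permutes {..<n}" and v: "v \<in> weight_space n m"
  shows "orth_proj n (isotypic n x) (perm_act \<sigma> v) = perm_act \<sigma> (orth_proj n (isotypic n x) v)"
proof (rule orth_proj_eqI[OF csubspace_isotypic isotypic_tvecs])
  let ?w = "orth_proj n (isotypic n x) v"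
  have w: "?w \<in> isotypic n x"
    unfolding orth_proj_isotypic[OF v] using csubspace_isotypic iso_proj_isotypic by (simp add: csubspace_def)
  then show "perm_act \<sigma> ?w \<in> isotypic n x" by (rule perm_act_isotypic[OF \<sigma>])
  fix u assume u: "u \<in> isotypic n x"
  have "perm_act \<sigma> (perm_act (inv \<sigma>) u) = u"
  proof (rule tvecs_eqI)
    show "u \<in> tvecs n" using u isotypic_tvecs by blast
    then show "perm_act \<sigma> (perm_act (inv \<sigma>) u) \<in> tvecs n" by (intro perm_act_tvecs)
    show "perm_act \<sigma> (perm_act (inv \<sigma>) u) ys = u ys" if "length ys = n" for ys
      using permute_list_inv(1)[of \<sigma> ys] \<sigma> that by (simp add: perm_act_def)
  qed
  then have "qinner n u (perm_act \<sigma> (\<lambda>ys. v ys - ?w ys))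
      = qinner n (perm_act (inv \<sigma>) u) (\<lambda>ys. v ys - ?w ys)"
    using qinner_perm_act[OF \<sigma>, of "perm_act (inv \<sigma>) u" "\<lambda>ys. v ys - ?w ys"] by simp
  also have "\<dots> = 0"
    by (rule orth_proj_isotypic_orthogonal[OF v perm_act_isotypic[OF permutes_inv[OF \<sigma>] u]])
  finally show "qinner n u (\<lambda>ys. perm_act \<sigma> v ys - perm_act \<sigma> ?w ys) = 0"
    by (simp add: perm_act_def)
qed

text \<open>Strings of equal weight are rearrangements of each other, and both the inner product and
  the projection respect the permutation.\<close>

lemma proj_diag_same_weight:
  assumes I: "length I = n" "wt I = m" and J: "length J = n" "wt J = m"
  shows "proj_diag n x I = proj_diag n x J"
proof -
  have count: "count (mset ys) True = wt ys" "count (mset ys) False = length ys - wt ys" for ys :: "bool list"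
  proof -
    have "count (mset ys) True = length (filter id ys)" "length (filter id ys) + count (mset ys) False = length ys"
      by (induction ys) auto
    then show "count (mset ys) True = wt ys" "count (mset ys) False = length ys - wt ys"
      by (simp_all add: wt_conv_filter)
  qed
  have "mset I = mset J"
  proof (rule multiset_eqI)
    show "count (mset I) t = count (mset J) t" for t using I J count by (cases t) simp_all
  qed
  then obtain \<sigma> where \<sigma>: "\<sigma> permutes {..<n}" and IJ: "permute_list \<sigma> J = I"
    using mset_eq_permutation[of I J] J(1) by metis
  have "perm_act \<sigma> (ket I) = ket J"
  proof (rule tvecs_eqI)
    show "perm_act \<sigma> (ket I) \<in> tvecs n" "ket J \<in> tvecs n"
      using ket_weight_space[OF I] ket_weight_space[OF J] weight_space_tvecs perm_act_tvecs by blast+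
    fix ys :: "bool list" assume "length ys = n"
    then have "permute_list \<sigma> ys = I \<longleftrightarrow> ys = J"
      using permute_list_inv(1)[of \<sigma> ys] permute_list_inv(1)[of \<sigma> J] \<sigma> J(1) IJ by metis
    then show "perm_act \<sigma> (ket I) ys = ket J ys" by (simp add: perm_act_def ket_def)
  qed
  then have "qinner n (ket J) (orth_proj n (isotypic n x) (ket J))
      = qinner n (perm_act \<sigma> (ket I)) (perm_act \<sigma> (orth_proj n (isotypic n x) (ket I)))"
    using orth_proj_perm_act[OF \<sigma> ket_weight_space[OF I]] by metis
  then show ?thesis by (simp add: proj_diag_def qinner_perm_act[OF \<sigma>])
qed

text \<open>The trace is spread evenly over the C(n,m) strings of weight \<open>m\<close>.\<close>

lemma proj_diag_card:
  assumes I: "length I = n" "wt I = m"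
  shows "real (n choose m) * proj_diag n x I
    = (if x \<le> m \<and> x + m \<le> n then real (card (specht_basis n x)) else 0)"
proof (cases "x \<le> m \<and> x + m \<le> n")
  case True
  have "(\<Sum>J\<in>{J. length J = n \<and> wt J = m}. proj_diag n x J)
      = (\<Sum>J\<in>{J. length J = n \<and> wt J = m}. proj_diag n x I)"
    by (rule sum.cong) (use proj_diag_same_weight[OF _ _ I] in auto)
  also have "\<dots> = real (n choose m) * proj_diag n x I"
    by (simp add: card_strings_wt)
  finally show ?thesis using True sum_proj_diag[of x m n] by simp
next
  case False
  then show ?thesis
    unfolding proj_diag_def orth_proj_isotypic[OF ket_weight_space[OF I]] if_not_P[OF False] by simp
qed

text \<open>What the projections miss of |I> is orthogonal to every raised polytabloid of weight
  \<open>m\<close>, hence 0 by \<open>completeness\<close>.\<close>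

lemma sum_proj_diag_eq_1:
  assumes I: "length I = n" "wt I = m"
  shows "(\<Sum>x\<le>m. proj_diag n x I) = 1"
proof -
  define w where "w x = orth_proj n (isotypic n x) (ket I)" for x
  have v: "ket I \<in> weight_space n m" by (rule ket_weight_space[OF I])
  have ww: "w x \<in> weight_space n m" for x
    unfolding w_def orth_proj_isotypic[OF v]
    using csubspace_weight_space[of n m] iso_proj_weight_space by (simp add: csubspace_def)
  define r where "r = (\<lambda>ys. ket I ys - (\<Sum>x\<le>m. 1 * w x ys))"
  have "r = (\<lambda>ys. 0)"
  proof (rule completeness)
    show "r \<in> weight_space n m"
      unfolding r_def by (intro csubspace_diff[OF csubspace_weight_space] csubspace_sum[OF csubspace_weight_space] v ww)
    fix x a b assume x: "x \<le> m" and tab: "tableau_cols n x a b"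
    let ?g = "(raise n ^^ (m - x)) (polytabloid n x a b)"
    have other: "qinner n ?g (w y) = 0" if "y \<noteq> x" for y
    proof (cases "y \<le> m \<and> y + m \<le> n")
      case True
      have "qinner n ?g ((raise n ^^ (m - y)) u) = 0" if "u \<in> specht_basis n y" for u
        using that specht_basis_subset[of n y] \<open>y \<noteq> x\<close>
        by (intro raise_pow_orthogonal_weights[where x = x and x' = y] polytabloid_weight_space[OF tab]
            lower_polytabloid[OF tab] specht_weight_space lower_specht) auto
      then show ?thesis
        unfolding w_def orth_proj_isotypic[OF v] if_P[OF True] iso_proj_def qinner_sum_right qinner_scale_right
        by simp
    next
      case False
      then show ?thesis by (auto simp add: w_def orth_proj_isotypic[OF v])
    qed
    have "qinner n ?g r = qinner n ?g (ket I) - (\<Sum>y\<le>m. qinner n ?g (w y))"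
      unfolding r_def qinner_diff_right by (simp add: qinner_sum_right)
    also have "(\<Sum>y\<le>m. qinner n ?g (w y)) = qinner n ?g (w x)"
      by (subst sum.remove[of _ x]) (use x other in auto)
    also have "qinner n ?g (ket I) - qinner n ?g (w x) = qinner n ?g (\<lambda>ys. ket I ys - w x ys)"
      by (rule qinner_diff_right[symmetric])
    also have "\<dots> = 0"
      unfolding w_def
      by (intro orth_proj_isotypic_orthogonal[OF v] raise_pow_specht_in_isotypic polytabloid_in_specht tab)
    finally show "qinner n ?g r = 0" .
  qed
  then have "r I = 0" by simp
  then have "(\<Sum>x\<le>m. w x I) = 1" by (simp add: r_def ket_def)
  moreover have "(\<Sum>x\<le>m. proj_diag n x I) = Re (\<Sum>x\<le>m. w x I)"
    by (simp add: proj_diag_def w_def qinner_ket[OF I(1)])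
  ultimately show ?thesis by simp
qed

section \<open>Dimension count and closed form of the distribution\<close>

lemma exists_string:
  assumes "m \<le> n"
  shows "\<exists>I. length I = n \<and> wt I = m"
  using assms by (intro exI[of _ "replicate m True @ replicate (n - m) False"]) (simp add: wt_conv_filter)

text \<open>With 2m \<le> n every x \<le> m satisfies x + m \<le> n, so each shape contributes its
  full dimension to the total probability 1.\<close>

lemma sum_card_specht_basis:
  assumes "2 * m \<le> n"
  shows "(\<Sum>x\<le>m. real (card (specht_basis n x))) = real (n choose m)"
proof -
  obtain I where I: "length I = n" "wt I = m" using exists_string[of m n] assms by auto
  have "(\<Sum>x\<le>m. real (card (specht_basis n x))) = (\<Sum>x\<le>m. real (n choose m) * proj_diag n x I)"
    by (rule sum.cong) (use assms in \<open>auto simp: proj_diag_card[OF I]\<close>)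
  then show ?thesis
    using sum_proj_diag_eq_1[OF I] by (simp flip: sum_distrib_left)
qed

text \<open>The fourth hypothesis leaves no choice in the tail: its n - k bits are all 0 or all 1,
  so the superposition is one string and the normalisation is 1.\<close>

lemma Xi_eq_ket:
  assumes "l \<le> k" "k \<le> n" "l \<le> m" and "m = l \<or> m - l = n - k"
  shows "\<exists>I. length I = n \<and> wt I = m \<and> Xi n m k l = ket I"
proof -
  \<comment> \<open>The common bit of the tail; if m = l and m - l = n - k both hold, the tail is
    empty.\<close>
  define t where "t = (m \<noteq> l)"
  have ml: "m - l = (if t then n - k else 0)" using assms(4) by (auto simp: t_def)
  have tail: "length (filter id ys) = m - l \<longleftrightarrow> ys = replicate (n - k) t" if "length ys = n - k" for ys
  proof -
    have "length (filter id ys) = length ys \<longleftrightarrow> (\<forall>z\<in>set ys. z = True)"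
    proof
      assume *: "length (filter id ys) = length ys"
      show "\<forall>z\<in>set ys. z = True"
      proof (rule ccontr)
        assume "\<not> (\<forall>z\<in>set ys. z = True)"
        then have "length (filter id ys) < length ys"
          by (metis id_apply length_filter_less)
        with * show False by simp
      qed
    qed simp
    moreover have "length (filter id ys) = 0 \<longleftrightarrow> (\<forall>z\<in>set ys. z = False)"
      by (simp add: filter_empty_conv)
    moreover have "ys = replicate (n - k) t \<longleftrightarrow> (\<forall>z\<in>set ys. z = t)"
      using that replicate_length_same[of ys t] by (metis in_set_replicate)
    ultimately show ?thesis using that unfolding ml by (cases t) simp_all
  qed
  define I where "I = replicate l True @ replicate (k - l) False @ replicate (n - k) t"
  have len: "length I = n" using assms by (simp add: I_def)
  have wt: "wt I = m" using ml assms(3) by (cases t) (simp_all add: I_def wt_conv_filter)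
  have "Xi n m k l xs = ket I xs" for xs
  proof -
    have "length xs = n \<and> take l xs = replicate l True \<and> take (k - l) (drop l xs) = replicate (k - l) False
        \<and> length (filter id (drop k xs)) = m - l \<longleftrightarrow> xs = I"
    proof
      assume *: "length xs = n \<and> take l xs = replicate l True \<and> take (k - l) (drop l xs) = replicate (k - l) False
        \<and> length (filter id (drop k xs)) = m - l"
      then have "drop k xs = replicate (n - k) t" using tail[of "drop k xs"] by simp
      moreover have "xs = take l xs @ take (k - l) (drop l xs) @ drop (k - l) (drop l xs)"
        by (simp only: append_take_drop_id)
      ultimately show "xs = I" unfolding I_def using * assms(1) by (metis drop_drop le_add_diff_inverse2)
    next
      assume "xs = I"
      moreover have "drop k I = replicate (n - k) t" using assms(1) by (simp add: I_def)
      ultimately show "length xs = n \<and> take l xs = replicate l True \<and> take (k - l) (drop l xs) = replicate (k - l) False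
        \<and> length (filter id (drop k xs)) = m - l"
        using len tail[of "drop k I"] assms(1) by (simp add: I_def)
    qed
    moreover have "(n - k) choose (m - l) = 1" using ml by simp
    ultimately show ?thesis by (simp add: Xi_def ket_def)
  qed
  then show ?thesis using len wt by blast
qed

text \<open>Telescoping form of \<open>p(x) = (C(n,x) - C(n,x-1)) / C(n,m)\<close> for \<open>x \<le> min(m, n-m)\<close>.\<close>

lemma p_dist_formula:
  assumes "l \<le> k" "k \<le> n" "l \<le> m" "m = l \<or> m - l = n - k"
    and M: "M = min m (n - m)" and "m \<le> n"
  shows "(\<Sum>x\<le>y. p_dist x n m k l) = real (n choose (min y M)) / real (n choose M)"
    and "x > M \<Longrightarrow> p_dist x n m k l = 0"
proof -
  obtain I where I: "length I = n" "wt I = m" "Xi n m k l = ket I"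
    using Xi_eq_ket assms by blast
  have p: "p_dist x n m k l = proj_diag n x I" for x
    by (simp add: p_dist_def proj_diag_def I(3))
  \<comment> \<open>The weight \<open>m\<close> may exceed n/2, so binomial symmetry is used to pass
    to \<open>M\<close>, the bound on the shapes that occur.\<close>
  have M': "n choose m = n choose M" using \<open>m \<le> n\<close> unfolding M
    by (cases "m \<le> n - m") (simp_all add: binomial_symmetric[of m n] min_def)
  have pos: "n choose M > 0" using \<open>m \<le> n\<close> by (simp add: M min_def)
  have p': "p_dist x n m k l = (if x \<le> M then real (card (specht_basis n x)) / real (n choose M) else 0)" for x
  proof -
    have "real (n choose M) * p_dist x n m k l = (if x \<le> M then real (card (specht_basis n x)) else 0)"
      using proj_diag_card[OF I(1,2), of x] \<open>m \<le> n\<close> unfolding p M' by (auto simp: M)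
    then show ?thesis using pos by (auto simp: field_simps split: if_splits)
  qed
  show "x > M \<Longrightarrow> p_dist x n m k l = 0" by (simp add: p')
  have "(\<Sum>x\<le>y. p_dist x n m k l) = (\<Sum>x\<le>min y M. real (card (specht_basis n x)) / real (n choose M))"
    by (rule sum.mono_neutral_cong_right) (auto simp: p')
  also have "\<dots> = real (n choose (min y M)) / real (n choose M)"
    using sum_card_specht_basis[of "min y M" n] by (simp add: M flip: sum_divide_distrib)
  finally show "(\<Sum>x\<le>y. p_dist x n m k l) = real (n choose (min y M)) / real (n choose M)" .
qed

subsection \<open>Asymptotics\<close>

text \<open>The distribution function of X at h - i. The value 0 for i > h stands for the empty
  event; truncated subtraction would give C(n,0) there instead.\<close>

definition binom_ratio :: "nat \<Rightarrow> nat \<Rightarrow> nat \<Rightarrow> real" where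
  "binom_ratio n h i = (if i \<le> h then real (n choose (h - i)) / real (n choose h) else 0)"

text \<open>The quotient of neighbouring binomial coefficients; for i \<ge> h the truncated
  numerator is 0, in agreement with the cut-off.\<close>

lemma binom_ratio_Suc:
  assumes "h \<le> n"
  shows "binom_ratio n h (Suc i) = binom_ratio n h i * (real (h - i) / (real n - real h + real i + 1))"
proof (cases "i < h")
  case True
  define k where "k = h - Suc i"
  have k: "h - i = Suc k" using True by (simp add: k_def)
  have "Suc k * (n choose Suc k) = (n - k) * (n choose k)"
    using binomial_absorption[of k n] binomial_absorb_comp[of n k] by simp
  then have "real (Suc k) * real (n choose Suc k) = real (n - k) * real (n choose k)"
    by (metis of_nat_mult)
  moreover have "real (n - k) = real n - real h + real i + 1"
    using assms True by (simp add: k_def of_nat_diff)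
  moreover have "real n - real h + real i + 1 > 0" using assms by simp
  ultimately have "real (n choose k) = real (n choose Suc k) * (real (Suc k) / (real n - real h + real i + 1))"
    by (simp add: field_simps)
  then show ?thesis
    using True k by (simp add: binom_ratio_def k_def)
next
  case False
  then show ?thesis by (simp add: binom_ratio_def)
qed

lemma binom_ratio_0: "h \<le> n \<Longrightarrow> binom_ratio n h 0 = 1"
  by (simp add: binom_ratio_def)

lemma binom_ratio_nonneg: "binom_ratio n h i \<ge> 0"
  by (simp add: binom_ratio_def)

text \<open>Every factor (h-i)/(n-h+i+1) is at most h/(n-h), which is exactly \<mu>/(1-\<mu>). The
  bound is free of \<open>n\<close> and becomes the dominating sequence.\<close>

lemma binom_ratio_bound:
  assumes \<mu>: "0 \<le> \<mu>" "\<mu> < 1" and h: "real h = \<mu> * real n" and n: "n > 0"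
  shows "binom_ratio n h i \<le> (\<mu> / (1 - \<mu>)) ^ i"
proof (induction i)
  case 0
  have "real h \<le> 1 * real n" unfolding h by (rule mult_right_mono) (use \<mu> in auto)
  then show ?case by (simp add: binom_ratio_0)
next
  case (Suc i)
  have hn: "real h < real n" unfolding h using \<mu> n by simp
  have "real (h - i) / (real n - real h + real i + 1) \<le> real h / (real n - real h)"
    by (rule frac_le) (use hn in auto)
  also have "\<dots> = \<mu> * real n / ((1 - \<mu>) * real n)" unfolding h by (simp add: algebra_simps)
  also have "\<dots> = \<mu> / (1 - \<mu>)" using n by simp
  finally have "binom_ratio n h i * (real (h - i) / (real n - real h + real i + 1))
      \<le> (\<mu> / (1 - \<mu>)) ^ i * (\<mu> / (1 - \<mu>))"
    using Suc.IH \<mu> hn by (intro mult_mono) auto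
  then show ?case using hn by (simp add: binom_ratio_Suc mult.commute)
qed

text \<open>Stated for a filter below \<open>sequentially\<close> because the limit is taken only
  along admissible \<open>n\<close>.\<close>

lemma binom_ratio_tendsto:
  assumes \<mu>: "0 \<le> \<mu>" "\<mu> < 1" and F: "F \<le> sequentially"
    and h: "eventually (\<lambda>n. real (h n) = \<mu> * real n) F"
  shows "((\<lambda>n. binom_ratio n (h n) i) \<longlongrightarrow> (\<mu> / (1 - \<mu>)) ^ i) F"
proof (induction i)
  case 0
  have "eventually (\<lambda>n. binom_ratio n (h n) 0 = 1) F"
    using h
  proof eventually_elim
    case (elim n)
    have "real (h n) \<le> 1 * real n" unfolding elim by (rule mult_right_mono) (use \<mu> in auto)
    then show ?case by (simp add: binom_ratio_0)
  qed
  then show ?case by (simp add: tendsto_eventually)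
next
  case (Suc i)
  \<comment> \<open>The step factor after division by n; the maximum mirrors the truncated
    subtraction in h - i.\<close>
  let ?g = "\<lambda>n. max 0 (\<mu> - real i / real n) / (1 - \<mu> + (real i + 1) / real n)"
  have "(\<lambda>n. c / real n) \<longlonglongrightarrow> 0" for c :: real
    by (rule lim_const_over_n)
  then have "?g \<longlonglongrightarrow> max 0 (\<mu> - 0) / (1 - \<mu> + 0)"
    using \<mu> by (intro tendsto_intros) auto
  then have g: "(?g \<longlongrightarrow> \<mu> / (1 - \<mu>)) F"
    using \<mu> tendsto_mono[OF F] by simp
  have pos: "eventually (\<lambda>n. n > 0) F"
    using F eventually_gt_at_top[of 0] by (simp add: filter_leD)
  have "eventually (\<lambda>n. binom_ratio n (h n) i * ?g n = binom_ratio n (h n) (Suc i)) F"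
    using h pos
  proof eventually_elim
    case (elim n)
    have le: "h n \<le> n"
    proof -
      have "real (h n) \<le> 1 * real n" unfolding elim(1) by (rule mult_right_mono) (use \<mu> in auto)
      then show ?thesis by simp
    qed
    have "real (h n - i) = max 0 (\<mu> * real n - real i)"
      unfolding elim(1)[symmetric] by (cases "i \<le> h n") (auto simp: of_nat_diff max_def)
    also have "\<dots> = real n * max 0 (\<mu> - real i / real n)"
      using elim(2) by (auto simp: max_def field_simps)
    finally have num: "real (h n - i) = real n * max 0 (\<mu> - real i / real n)" .
    have den: "real n - real (h n) + real i + 1 = real n * (1 - \<mu> + (real i + 1) / real n)"
      unfolding elim(1) using elim(2) by (simp add: field_simps)
    have "real (h n - i) / (real n - real (h n) + real i + 1) = ?g n"
      unfolding num den using elim(2) by simp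
    then show ?case by (simp add: binom_ratio_Suc[OF le])
  qed
  moreover have "((\<lambda>n. binom_ratio n (h n) i * ?g n) \<longlongrightarrow> (\<mu> / (1 - \<mu>)) ^ i * (\<mu> / (1 - \<mu>))) F"
    by (rule tendsto_mult[OF Suc.IH g])
  ultimately show ?case
    by (simp add: mult.commute Lim_transform_eventually)
qed

text \<open>Tannery's theorem exchanges limit and sum; the finite sums are series because the ratios
  vanish beyond \<open>h\<close>.\<close>

lemma suminf_binom_ratio_tendsto:
  assumes \<mu>: "0 \<le> \<mu>" "\<mu> < 1" and F: "F \<le> sequentially"
    and h: "eventually (\<lambda>n. real (h n) = \<mu> * real n) F"
    and c: "\<And>i. c i \<ge> 0" and sums: "(\<lambda>i. c i * (\<mu> / (1 - \<mu>)) ^ Suc i) sums s"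
  shows "((\<lambda>n. \<Sum>i<h n. c i * binom_ratio n (h n) (Suc i)) \<longlongrightarrow> s) F"
\<comment> \<open>Tannery's theorem wants a proper filter; along the trivial one every limit
  holds.\<close>
proof (cases "F = bot")
  case False
  have pos: "eventually (\<lambda>n. n > 0) F"
    using F eventually_gt_at_top[of 0] by (simp add: filter_leD)
  have "eventually (\<lambda>n. \<forall>i. norm (c i * binom_ratio n (h n) (Suc i)) \<le> c i * (\<mu> / (1 - \<mu>)) ^ Suc i) F"
    using h pos
  proof eventually_elim
    case (elim n)
    show ?case
    proof
      fix i
      have "norm (c i * binom_ratio n (h n) (Suc i)) = c i * binom_ratio n (h n) (Suc i)"
        using c binom_ratio_nonneg by (simp add: abs_mult)
      also have "\<dots> \<le> c i * (\<mu> / (1 - \<mu>)) ^ Suc i"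
        by (rule mult_left_mono[OF binom_ratio_bound[OF \<mu> elim] c])
      finally show "norm (c i * binom_ratio n (h n) (Suc i)) \<le> c i * (\<mu> / (1 - \<mu>)) ^ Suc i" .
    qed
  qed
  from eventually_prodI[of "\<lambda>_. True", OF eventually_True this]
  have bound: "eventually (\<lambda>(i, n). norm (c i * binom_ratio n (h n) (Suc i)) \<le> c i * (\<mu> / (1 - \<mu>)) ^ Suc i)
      (at_top \<times>\<^sub>F F)"
    by (rule eventually_mono) (simp only: case_prod_beta simp_thms)
  have "((\<lambda>n. \<Sum>i. c i * binom_ratio n (h n) (Suc i)) \<longlongrightarrow> (\<Sum>i. c i * (\<mu> / (1 - \<mu>)) ^ Suc i)) F"
    using tannerys_theorem[OF tendsto_mult_left[OF binom_ratio_tendsto[OF \<mu> F h]] bound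
        sums_summable[OF sums] False] by blast
  moreover have "(\<Sum>i. c i * binom_ratio n (h n) (Suc i)) = (\<Sum>i<h n. c i * binom_ratio n (h n) (Suc i))" for n
    by (rule suminf_finite) (auto simp: binom_ratio_def)
  ultimately show ?thesis using sums_unique[OF sums] by simp
qed simp

text \<open>Abel summation, which turns moments of X into sums over its distribution
  function.\<close>

lemma sum_by_parts:
  fixes f a :: "nat \<Rightarrow> real"
  shows "(\<Sum>i\<le>N. f i * (a i - a (Suc i)))
    = f 0 * a 0 + (\<Sum>i<N. (f (Suc i) - f i) * a (Suc i)) - f N * a (Suc N)"
  by (induction N) (simp_all add: algebra_simps)

section \<open>Probabilities and moments in terms of the binomial ratios\<close>

context
  fixes n m k l h :: nat
  assumes params: "l \<le> k" "k \<le> n" "l \<le> m" "m = l \<or> m - l = n - k" "m \<le> n"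
    and h: "h = min m (n - m)"
begin

lemma p_dist_binom_ratio:
  assumes "i \<le> h"
  shows "p_dist (h - i) n m k l = binom_ratio n h i - binom_ratio n h (Suc i)"
proof -
  note cdf = p_dist_formula(1)[OF params(1-4) h params(5)]
  show ?thesis
  \<comment> \<open>At i = h the truncated h - (i+1) would again be 0, so the value X = 0 is treated
    apart.\<close>
  proof (cases "i = h")
    case True
    then show ?thesis using cdf[of 0] by (simp add: binom_ratio_def)
  next
    case False
    then have "h - i = Suc (h - Suc i)" using assms by simp
    then have "p_dist (h - i) n m k l = (\<Sum>x\<le>h - i. p_dist x n m k l) - (\<Sum>x\<le>h - Suc i. p_dist x n m k l)"
      by simp
    then show ?thesis unfolding cdf using assms False by (simp add: binom_ratio_def min_def)
  qed
qed

lemma prob_X_binom_ratio: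
  "prob_X n m k l (int h - int i) = binom_ratio n h i - binom_ratio n h (Suc i)"
proof (cases "i \<le> h")
  case True
  then have "nat (int h - int i) = h - i" by simp
  moreover have "int h - int i \<le> int (n div 2)" using h by simp
  ultimately show ?thesis using True p_dist_binom_ratio[OF True] by (simp add: prob_X_def)
next
  case False
  then show ?thesis by (simp add: prob_X_def binom_ratio_def)
qed

text \<open>Abel summation with the boundary values 1 of the ratio at 0 and 0 at h + 1.\<close>

lemma sum_p_dist:
  "(\<Sum>x\<le>n div 2. f x * p_dist x n m k l) = f h + (\<Sum>i<h. (f (h - Suc i) - f (h - i)) * binom_ratio n h (Suc i))"
proof -
  have "h \<le> n" using h by simp
  have "(\<Sum>x\<le>n div 2. f x * p_dist x n m k l) = (\<Sum>x\<le>h. f x * p_dist x n m k l)"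
    by (rule sum.mono_neutral_right)
      (use p_dist_formula(2)[OF params(1-4) h params(5)] h in auto)
  also have "\<dots> = (\<Sum>i\<le>h. f (h - i) * p_dist (h - i) n m k l)"
    by (rule sum.reindex_bij_witness[where i = "\<lambda>i. h - i" and j = "\<lambda>i. h - i"]) auto
  also have "\<dots> = (\<Sum>i\<le>h. f (h - i) * (binom_ratio n h i - binom_ratio n h (Suc i)))"
    by (rule sum.cong) (simp_all add: p_dist_binom_ratio)
  also have "\<dots> = f h + (\<Sum>i<h. (f (h - Suc i) - f (h - i)) * binom_ratio n h (Suc i))"
    using sum_by_parts[of "\<lambda>i. f (h - i)" "binom_ratio n h" h] \<open>h \<le> n\<close>
    by (simp add: binom_ratio_0) (simp add: binom_ratio_def)
  finally show ?thesis .
qed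

lemma expect_X_binom_ratio:
  "expect_X n m k l = real h - (\<Sum>i<h. 1 * binom_ratio n h (Suc i))"
proof -
  have "(\<Sum>i<h. (real (h - Suc i) - real (h - i)) * binom_ratio n h (Suc i))
      = (\<Sum>i<h. - (1 * binom_ratio n h (Suc i)))"
    by (rule sum.cong) (simp_all add: of_nat_diff)
  then show ?thesis by (simp add: expect_X_def sum_p_dist sum_negf)
qed

text \<open>Let A be the sum of the ratios. Since (h-i-1)^2 - (h-i)^2 = 2i + 1 - 2h, the second
  moment contains h^2 - 2hA, and subtracting (h - A)^2 cancels every term that grows with n.\<close>

lemma var_X_binom_ratio:
  "var_X n m k l = (\<Sum>i<h. (2 * real i + 1) * binom_ratio n h (Suc i))
    - (\<Sum>i<h. 1 * binom_ratio n h (Suc i))\<^sup>2"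
proof -
  have "(\<Sum>i<h. ((real (h - Suc i))\<^sup>2 - (real (h - i))\<^sup>2) * binom_ratio n h (Suc i))
      = (\<Sum>i<h. (2 * real i + 1) * binom_ratio n h (Suc i) - 2 * real h * (1 * binom_ratio n h (Suc i)))"
    by (rule sum.cong) (simp_all add: of_nat_diff power2_eq_square algebra_simps)
  then have "(\<Sum>x\<le>n div 2. (real x)\<^sup>2 * p_dist x n m k l)
      = (real h)\<^sup>2 + (\<Sum>i<h. (2 * real i + 1) * binom_ratio n h (Suc i))
        - 2 * real h * (\<Sum>i<h. 1 * binom_ratio n h (Suc i))"
    unfolding sum_p_dist by (simp add: sum_subtractf sum_distrib_left)
  then show ?thesis
    unfolding var_X_def expect_X_binom_ratio by (simp add: power2_eq_square algebra_simps)
qed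

end

section \<open>Limits along the admissible n\<close>

theorem theorem5p7:
  fixes \<alpha> \<beta> \<gamma> \<delta> :: real
  assumes nonneg: "\<alpha> \<ge> 0" "\<beta> \<ge> 0" "\<gamma> \<ge> 0" "\<delta> \<ge> 0"
    and sum1: "\<alpha> + \<beta> + \<gamma> + \<delta> = 1"
    and bd: "\<beta> * \<delta> = 0"
    and xi_ne: "\<alpha> + \<beta> \<noteq> 1 / 2"
  defines "\<mu> \<equiv> (if \<alpha> + \<beta> < 1 / 2 then \<alpha> + \<beta> else 1 - (\<alpha> + \<beta>))"
    and "S \<equiv> {n :: nat. \<alpha> * real n \<in> \<int> \<and> (\<alpha> + \<beta>) * real n \<in> \<int> \<and> (\<alpha> + \<gamma>) * real n \<in> \<int>}"
    and "L \<equiv> (\<lambda>n :: nat. nat \<lfloor>\<alpha> * real n\<rfloor>)"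
    and "M \<equiv> (\<lambda>n :: nat. nat \<lfloor>(\<alpha> + \<beta>) * real n\<rfloor>)"
    and "K \<equiv> (\<lambda>n :: nat. nat \<lfloor>(\<alpha> + \<gamma>) * real n\<rfloor>)"
  shows "\<mu> = (1 - sqrt (1 - 4 * (\<alpha> * \<gamma> + \<alpha> * \<delta> + \<beta> * \<gamma>))) / 2
    \<and> (\<forall>i :: nat. ((\<lambda>n. prob_X n (M n) (K n) (L n) (\<lfloor>real n * \<mu>\<rfloor> - int i))
           \<longlongrightarrow> (\<mu> / (1 - \<mu>)) ^ i * ((1 - 2 * \<mu>) / (1 - \<mu>))) (inf sequentially (principal S)))
    \<and> ((\<lambda>n. expect_X n (M n) (K n) (L n) - (real n * \<mu> - \<mu> / (1 - 2 * \<mu>)))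
           \<longlongrightarrow> 0) (inf sequentially (principal S))
    \<and> ((\<lambda>n. var_X n (M n) (K n) (L n))
           \<longlongrightarrow> \<mu> * (1 - \<mu>) / (1 - 2 * \<mu>)\<^sup>2) (inf sequentially (principal S))"
proof -
  \<comment> \<open>This filter means that n tends to infinity inside \<open>S\<close>, where all
    the floors are exact.\<close>
  let ?F = "inf sequentially (principal S)"
  define r where "r = \<mu> / (1 - \<mu>)"
  define h where "h n = min (M n) (n - M n)" for n
  have \<mu>: "0 \<le> \<mu>" "\<mu> < 1 / 2" using nonneg sum1 xi_ne by (auto simp: \<mu>_def)
  then have \<mu>1: "\<mu> < 1" and r: "0 \<le> r" "r < 1" by (simp_all add: r_def)
  have F: "?F \<le> sequentially" by simp
  have inS: "eventually (\<lambda>n. n \<in> S) ?F"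
    by (simp add: eventually_inf_principal)

  have params: "L n \<le> K n" "K n \<le> n" "L n \<le> M n" "M n = L n \<or> M n - L n = n - K n" "M n \<le> n"
    and h_eq: "real (h n) = \<mu> * real n" if "n \<in> S" for n
  proof -
    have nat_floor: "real (nat \<lfloor>c * real n\<rfloor>) = c * real n" if "c \<ge> 0" "c * real n \<in> \<int>" for c
      using that by (auto elim: Ints_cases)
    have LMK: "real (L n) = \<alpha> * real n" "real (M n) = (\<alpha> + \<beta>) * real n" "real (K n) = (\<alpha> + \<gamma>) * real n"
      using \<open>n \<in> S\<close> nonneg unfolding L_def M_def K_def S_def by (auto intro!: nat_floor)
    have mono: "c \<le> d \<Longrightarrow> c * real n \<le> d * real n" for c d by (rule mult_right_mono) auto
    show "L n \<le> K n" using mono[of \<alpha> "\<alpha> + \<gamma>"] nonneg LMK by simp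
    show "K n \<le> n" using mono[of "\<alpha> + \<gamma>" 1] nonneg sum1 LMK by simp
    show LM: "L n \<le> M n" using mono[of \<alpha> "\<alpha> + \<beta>"] nonneg LMK by simp
    show Mn: "M n \<le> n" using mono[of "\<alpha> + \<beta>" 1] nonneg sum1 LMK by simp
    \<comment> \<open>\<beta> = 0 puts only zeros in the tail of the string, \<delta> = 0 only
      ones.\<close>
    show "M n = L n \<or> M n - L n = n - K n"
    proof (cases "\<beta> = 0")
      case True
      then have "real (M n) = real (L n)" using LMK by simp
      then show ?thesis by simp
    next
      case False
      then have "\<delta> = 0" using bd by simp
      then have "\<alpha> + \<beta> + \<gamma> = 1" using sum1 by simp
      moreover have "real (M n) + real (K n) = (\<alpha> + \<beta> + \<gamma>) * real n + real (L n)"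
        unfolding LMK by (simp add: algebra_simps)
      ultimately have "real (M n) + real (K n) = real n + real (L n)" by simp
      then show ?thesis by linarith
    qed
    have "real (n - M n) = (1 - (\<alpha> + \<beta>)) * real n"
      using Mn LMK by (simp add: of_nat_diff algebra_simps)
    moreover have "real (h n) = min (real (M n)) (real (n - M n))"
      unfolding h_def by (rule of_nat_min)
    ultimately show "real (h n) = \<mu> * real n"
      using LMK(2) mono[of "\<alpha> + \<beta>" "1 - (\<alpha> + \<beta>)"] mono[of "1 - (\<alpha> + \<beta>)" "\<alpha> + \<beta>"]
      by (auto simp: \<mu>_def min_def)
  qed
  have ev_h: "eventually (\<lambda>n. real (h n) = \<mu> * real n) ?F"
    using inS by eventually_elim (rule h_eq)
  note ratio = binom_ratio_tendsto[OF \<mu>(1) \<mu>1 F ev_h]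

  have "(\<lambda>i. r ^ i * r) sums (1 / (1 - r) * r)"
    using r by (intro sums_mult2 geometric_sums) simp
  then have sums1: "(\<lambda>i. 1 * r ^ Suc i) sums (r / (1 - r))"
    by (simp add: mult.commute)
  \<comment> \<open>2i + 1 = 2(i+1) - 1 splits the series into the derivative of the geometric
    series and the geometric series itself.\<close>
  have "(\<lambda>i. (of_nat (Suc i) * r ^ i) * (2 * r) - 1 * r ^ Suc i) sums (1 / (1 - r)\<^sup>2 * (2 * r) - r / (1 - r))"
    using r by (intro sums_diff sums_mult2 geometric_deriv_sums sums1) simp
  then have sums2: "(\<lambda>i. (2 * real i + 1) * r ^ Suc i) sums (1 / (1 - r)\<^sup>2 * (2 * r) - r / (1 - r))"
    by (simp add: algebra_simps)
  note lim = suminf_binom_ratio_tendsto[OF \<mu>(1) \<mu>1 F ev_h, folded r_def]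
  have A: "((\<lambda>n. \<Sum>i<h n. 1 * binom_ratio n (h n) (Suc i)) \<longlongrightarrow> r / (1 - r)) ?F"
    by (rule lim[OF _ sums1]) simp
  have B: "((\<lambda>n. \<Sum>i<h n. (2 * real i + 1) * binom_ratio n (h n) (Suc i))
      \<longlongrightarrow> 1 / (1 - r)\<^sup>2 * (2 * r) - r / (1 - r)) ?F"
    by (rule lim[OF _ sums2]) simp
  have r1: "1 - r = (1 - 2 * \<mu>) / (1 - \<mu>)" using \<mu>1 by (simp add: r_def field_simps)
  have mean: "r / (1 - r) = \<mu> / (1 - 2 * \<mu>)" unfolding r1 using \<mu> by (simp add: r_def)
  have variance: "1 / (1 - r)\<^sup>2 * (2 * r) - r / (1 - r) - (r / (1 - r))\<^sup>2 = \<mu> * (1 - \<mu>) / (1 - 2 * \<mu>)\<^sup>2"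
  proof -
    have "1 / (1 - r)\<^sup>2 * (2 * r) - r / (1 - r) - (r / (1 - r))\<^sup>2 = r / (1 - r)\<^sup>2"
      using r by (simp add: divide_simps power2_eq_square) (simp add: algebra_simps)
    also have "\<dots> = \<mu> * (1 - \<mu>) / (1 - 2 * \<mu>)\<^sup>2"
      unfolding r1 using \<mu> by (simp add: r_def divide_simps power2_eq_square)
    finally show ?thesis .
  qed

  have "\<mu> = (1 - sqrt (1 - 4 * (\<alpha> * \<gamma> + \<alpha> * \<delta> + \<beta> * \<gamma>))) / 2"
  proof -
    have "\<gamma> + \<delta> = 1 - (\<alpha> + \<beta>)" using sum1 by simp
    \<comment> \<open>Expanding (\<alpha>+\<beta>)(\<gamma>+\<delta>) leaves the extra term
      \<beta>\<delta> = 0. The radicand becomes a square, and its root |1 - 2(\<alpha>+\<beta>)|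
      covers both cases of \<mu>.\<close>
    then have "\<alpha> * \<gamma> + \<alpha> * \<delta> + \<beta> * \<gamma> = (\<alpha> + \<beta>) * (1 - (\<alpha> + \<beta>))"
      using bd by (metis add.right_neutral distrib_left distrib_right add.assoc)
    then have "1 - 4 * (\<alpha> * \<gamma> + \<alpha> * \<delta> + \<beta> * \<gamma>) = (1 - 2 * (\<alpha> + \<beta>))\<^sup>2"
      by (simp add: power2_eq_square algebra_simps)
    then show ?thesis by (auto simp: \<mu>_def)
  qed
  moreover have "((\<lambda>n. prob_X n (M n) (K n) (L n) (\<lfloor>real n * \<mu>\<rfloor> - int i))
      \<longlongrightarrow> (\<mu> / (1 - \<mu>)) ^ i * ((1 - 2 * \<mu>) / (1 - \<mu>))) ?F" for i
  proof -
    have "((\<lambda>n. binom_ratio n (h n) i - binom_ratio n (h n) (Suc i)) \<longlongrightarrow> r ^ i - r ^ Suc i) ?F"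
      unfolding r_def by (intro tendsto_diff ratio)
    also have "r ^ i - r ^ Suc i = r ^ i * (1 - r)" by (simp add: algebra_simps)
    finally have "((\<lambda>n. binom_ratio n (h n) i - binom_ratio n (h n) (Suc i))
        \<longlongrightarrow> (\<mu> / (1 - \<mu>)) ^ i * ((1 - 2 * \<mu>) / (1 - \<mu>))) ?F"
      unfolding r1 by (simp add: r_def)
    moreover have "eventually (\<lambda>n. binom_ratio n (h n) i - binom_ratio n (h n) (Suc i)
        = prob_X n (M n) (K n) (L n) (\<lfloor>real n * \<mu>\<rfloor> - int i)) ?F"
      using inS
    proof eventually_elim
      case (elim n)
      \<comment> \<open>On \<open>S\<close> the number n \<mu> is the integer \<open>h n\<close>, so
        the floor changes nothing.\<close>
      have "real n * \<mu> = of_int (int (h n))" using h_eq[OF elim] by (simp add: mult.commute)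
      then have "\<lfloor>real n * \<mu>\<rfloor> = int (h n)" by (simp only: floor_of_int)
      then show ?case using prob_X_binom_ratio[OF params[OF elim] h_def] by simp
    qed
    ultimately show ?thesis by (rule Lim_transform_eventually)
  qed
  moreover have "((\<lambda>n. expect_X n (M n) (K n) (L n) - (real n * \<mu> - \<mu> / (1 - 2 * \<mu>))) \<longlongrightarrow> 0) ?F"
  proof -
    have "((\<lambda>n. \<mu> / (1 - 2 * \<mu>) - (\<Sum>i<h n. 1 * binom_ratio n (h n) (Suc i)))
        \<longlongrightarrow> \<mu> / (1 - 2 * \<mu>) - r / (1 - r)) ?F"
      by (intro tendsto_diff tendsto_const A)
    then have "((\<lambda>n. \<mu> / (1 - 2 * \<mu>) - (\<Sum>i<h n. 1 * binom_ratio n (h n) (Suc i))) \<longlongrightarrow> 0) ?F"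
      by (simp add: mean)
    moreover have "eventually (\<lambda>n. \<mu> / (1 - 2 * \<mu>) - (\<Sum>i<h n. 1 * binom_ratio n (h n) (Suc i))
        = expect_X n (M n) (K n) (L n) - (real n * \<mu> - \<mu> / (1 - 2 * \<mu>))) ?F"
      using inS
    proof eventually_elim
      case (elim n)
      show ?case
        using expect_X_binom_ratio[OF params[OF elim] h_def] h_eq[OF elim] by (simp add: mult.commute)
    qed
    ultimately show ?thesis by (rule Lim_transform_eventually)
  qed
  moreover have "((\<lambda>n. var_X n (M n) (K n) (L n)) \<longlongrightarrow> \<mu> * (1 - \<mu>) / (1 - 2 * \<mu>)\<^sup>2) ?F"
  proof -
    have "((\<lambda>n. (\<Sum>i<h n. (2 * real i + 1) * binom_ratio n (h n) (Suc i))
        - (\<Sum>i<h n. 1 * binom_ratio n (h n) (Suc i))\<^sup>2) \<longlongrightarrow> \<mu> * (1 - \<mu>) / (1 - 2 * \<mu>)\<^sup>2) ?F"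
      unfolding variance[symmetric] by (intro tendsto_diff tendsto_power A B)
    moreover have "eventually (\<lambda>n. (\<Sum>i<h n. (2 * real i + 1) * binom_ratio n (h n) (Suc i))
        - (\<Sum>i<h n. 1 * binom_ratio n (h n) (Suc i))\<^sup>2 = var_X n (M n) (K n) (L n)) ?F"
      using inS
    proof eventually_elim
      case (elim n)
      show ?case by (rule var_X_binom_ratio[OF params[OF elim] h_def, symmetric])
    qed
    ultimately show ?thesis by (rule Lim_transform_eventually)
  qed
  ultimately show ?thesis by blast
qed

end
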